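(* Let $k$ be an algebraically closed field of characteristic zero and let $n \geq 4$ be an integer. Then any (finite-dimensional) semisimple Lie algebra $\mathfrak{g}$ over $k$ is a quotient of the Yang-Mills algebra $\mathfrak{ym}(n)$; that is, there exists a surjective morphism of Lie algebras $\mathfrak{ym}(n) \to \mathfrak{g}$.
   Context: For an integer $n \geq 2$, let $\mathfrak{f}(x_1,\dots,x_n)$ be the free Lie algebra over $k$ on generators $x_1,\dots,x_n$. The Yang-Mills algebra on $n$ generators is the quotient Lie algebra $$\mathfrak{ym}(n) = \mathfrak{f}(x_1,\dots,x_n)\big/\big\langle \textstyle\sum_{i=1}^n [x_i,[x_i,x_j]] : 1 \leq j \leq n \big\rangle,$$ where $\langle\,\cdot\,\rangle$ denotes the Lie ideal generated by the given elements. *)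

theory Defs
  imports "HOL-Computational_Algebra.Polynomial" "HOL-Library.Cardinality" "HOL-Library.Poly_Mapping"
begin

section \<open>Nonassociative algebras, Lie algebras and their ideals\<close>

text \<open>Algebras live on a whole type, with scalar multiplication and product as locale
  parameters (the style of \<^locale>\<open>vector_space\<close>).\<close>

locale nonassoc_algebra = vector_space scale
  for scale :: "'k::field \<Rightarrow> 'a::ab_group_add \<Rightarrow> 'a" (infixr \<open>*s\<close> 75) +
  fixes br :: "'a \<Rightarrow> 'a \<Rightarrow> 'a"
  assumes br_add_left: "br (x + y) z = br x z + br y z"
    and br_add_right: "br x (y + z) = br x y + br x z"
    and br_scale_left: "br (c *s x) y = c *s br x y"
    and br_scale_right: "br x (c *s y) = c *s br x y"
begin

definition ideal :: "'a set \<Rightarrow> bool" where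
  "ideal I \<longleftrightarrow> subspace I \<and> (\<forall>x. \<forall>y\<in>I. br x y \<in> I \<and> br y x \<in> I)"

lemma ideal_hull: "ideal (ideal hull S)"
  by (rule hull_in) (auto simp: ideal_def intro!: subspace_Inter)

lemma br_diff_left: "br (x - y) z = br x z - br y z"
  using br_add_left[of "x - y" y z] by simp

lemma br_diff_right: "br x (y - z) = br x y - br x z"
  using br_add_right[of x "y - z" z] by simp

lemma ideal_congruence:
  assumes "ideal I"
  shows "x - x \<in> I"
    and "x - y \<in> I \<Longrightarrow> y - x \<in> I"
    and "x - y \<in> I \<Longrightarrow> y - z \<in> I \<Longrightarrow> x - z \<in> I"
    and "x - x' \<in> I \<Longrightarrow> y - y' \<in> I \<Longrightarrow> (x + y) - (x' + y') \<in> I"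
    and "x - x' \<in> I \<Longrightarrow> y - y' \<in> I \<Longrightarrow> (x - y) - (x' - y') \<in> I"
    and "x - x' \<in> I \<Longrightarrow> - x - (- x') \<in> I"
    and "x - x' \<in> I \<Longrightarrow> c *s x - c *s x' \<in> I"
    and "x - x' \<in> I \<Longrightarrow> y - y' \<in> I \<Longrightarrow> br x y - br x' y' \<in> I"
proof -
  have sub: "subspace I" and l: "\<And>x y. y \<in> I \<Longrightarrow> br x y \<in> I"
    and r: "\<And>x y. y \<in> I \<Longrightarrow> br y x \<in> I"
    using assms by (auto simp: ideal_def)
  show "x - x \<in> I"
    using subspace_0[OF sub] by simp
  show "x - y \<in> I \<Longrightarrow> y - x \<in> I"
    using subspace_neg[OF sub, of "x - y"] by simp
  show "x - y \<in> I \<Longrightarrow> y - z \<in> I \<Longrightarrow> x - z \<in> I"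
    using subspace_add[OF sub, of "x - y" "y - z"] by simp
  show "x - x' \<in> I \<Longrightarrow> y - y' \<in> I \<Longrightarrow> (x + y) - (x' + y') \<in> I"
    using subspace_add[OF sub, of "x - x'" "y - y'"] by (simp add: algebra_simps)
  show "x - x' \<in> I \<Longrightarrow> y - y' \<in> I \<Longrightarrow> (x - y) - (x' - y') \<in> I"
    using subspace_diff[OF sub, of "x - x'" "y - y'"] by (simp add: algebra_simps)
  show "x - x' \<in> I \<Longrightarrow> - x - (- x') \<in> I"
    using subspace_neg[OF sub, of "x - x'"] by simp
  show "x - x' \<in> I \<Longrightarrow> c *s x - c *s x' \<in> I"
    using subspace_scale[OF sub, of "x - x'" c] by (simp add: scale_right_diff_distrib)
  show "br x y - br x' y' \<in> I" if "x - x' \<in> I" "y - y' \<in> I"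
    using subspace_add[OF sub r[OF that(1), of y] l[OF that(2), of x']]
    by (simp add: br_diff_left br_diff_right)
qed

end

locale lie_algebra = nonassoc_algebra scale br
  for scale :: "'k::field \<Rightarrow> 'a::ab_group_add \<Rightarrow> 'a" (infixr \<open>*s\<close> 75)
    and br :: "'a \<Rightarrow> 'a \<Rightarrow> 'a" +
  assumes alternating: "br x x = 0"
    and jacobi: "br x (br y z) + br y (br z x) + br z (br x y) = 0"
begin

fun derived_series :: "'a set \<Rightarrow> nat \<Rightarrow> 'a set" where
  "derived_series I 0 = I"
| "derived_series I (Suc m) =
     span {br x y | x y. x \<in> derived_series I m \<and> y \<in> derived_series I m}"

definition solvable :: "'a set \<Rightarrow> bool" where
  "solvable I \<longleftrightarrow> (\<exists>m. derived_series I m = {0})"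

end

text \<open>Semisimplicity is vanishing of the radical, i.e. there is no nonzero solvable ideal;
  the zero algebra counts as semisimple.\<close>

locale semisimple_lie_algebra = lie_algebra scale br
  for scale :: "'k::field \<Rightarrow> 'a::ab_group_add \<Rightarrow> 'a" (infixr \<open>*s\<close> 75)
    and br :: "'a \<Rightarrow> 'a \<Rightarrow> 'a" +
  assumes finite_dimensional: "\<exists>B. finite B \<and> span B = UNIV"
    and solvable_ideal_trivial: "ideal I \<Longrightarrow> solvable I \<Longrightarrow> I = {0}"

locale lie_algebra_hom =
  source: lie_algebra s1 br1 + target: lie_algebra s2 br2 + Vector_Spaces.linear s1 s2 f
  for s1 :: "'k::field \<Rightarrow> 'a::ab_group_add \<Rightarrow> 'a" and br1 :: "'a \<Rightarrow> 'a \<Rightarrow> 'a"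
    and s2 :: "'k \<Rightarrow> 'b::ab_group_add \<Rightarrow> 'b" and br2 :: "'b \<Rightarrow> 'b \<Rightarrow> 'b"
    and f :: "'a \<Rightarrow> 'b" +
  assumes map_br: "f (br1 x y) = br2 (f x) (f y)"


section \<open>Free Lie algebras\<close>

datatype 'n magma = Gen 'n | Node "'n magma" "'n magma"

text \<open>The free nonassociative algebra over \<open>'k\<close> on the generating set \<open>'n\<close> is the space
  of finitely supported functions \<open>'n magma \<Rightarrow>\<^sub>0 'k\<close>. As every tree is a generator or splits
  uniquely, the coefficient of a product at \<open>Node s t\<close> has only one contribution.\<close>

definition magma_scale :: "'k::field \<Rightarrow> ('n magma \<Rightarrow>\<^sub>0 'k) \<Rightarrow> ('n magma \<Rightarrow>\<^sub>0 'k)" where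
  "magma_scale c = Poly_Mapping.map ((*) c)"

lift_definition magma_mult ::
  "('n magma \<Rightarrow>\<^sub>0 'k::field) \<Rightarrow> ('n magma \<Rightarrow>\<^sub>0 'k) \<Rightarrow> ('n magma \<Rightarrow>\<^sub>0 'k)" is
  "\<lambda>f g t. case t of Gen i \<Rightarrow> 0 | Node r s \<Rightarrow> f r * g s"
proof -
  fix f g :: "'n magma \<Rightarrow> 'k"
  assume fin: "finite {t. f t \<noteq> 0}" "finite {t. g t \<noteq> 0}"
  have "{t. (case t of Gen i \<Rightarrow> 0 | Node r s \<Rightarrow> f r * g s) \<noteq> 0}
      \<subseteq> (\<lambda>(r, s). Node r s) ` ({t. f t \<noteq> 0} \<times> {t. g t \<noteq> 0})"
  proof
    fix t assume "t \<in> {t. (case t of Gen i \<Rightarrow> 0 | Node r s \<Rightarrow> f r * g s) \<noteq> 0}"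
    then show "t \<in> (\<lambda>(r, s). Node r s) ` ({t. f t \<noteq> 0} \<times> {t. g t \<noteq> 0})"
      by (cases t) auto
  qed
  then show "finite {t. (case t of Gen i \<Rightarrow> 0 | Node r s \<Rightarrow> f r * g s) \<noteq> 0}"
    by (rule finite_subset) (use fin in auto)
qed

lemma lookup_magma_scale [simp]:
  "Poly_Mapping.lookup (magma_scale c f) t = c * Poly_Mapping.lookup f t"
  by (simp add: magma_scale_def Poly_Mapping.map.rep_eq when_def)

lemma lookup_magma_mult:
  "Poly_Mapping.lookup (magma_mult f g) t =
     (case t of Gen i \<Rightarrow> 0 | Node r s \<Rightarrow> Poly_Mapping.lookup f r * Poly_Mapping.lookup g s)"
  by (simp add: magma_mult.rep_eq)

interpretation free_magma_algebra: nonassoc_algebra magma_scale magma_mult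
  by unfold_locales
    (auto intro!: poly_mapping_eqI
      simp: lookup_add lookup_magma_mult algebra_simps split: magma.splits)

definition free_lie_relators :: "('n magma \<Rightarrow>\<^sub>0 'k::field) set" where
  "free_lie_relators =
     {magma_mult x x | x. True} \<union>
     {magma_mult x (magma_mult y z) + magma_mult y (magma_mult z x)
        + magma_mult z (magma_mult x y) | x y z. True}"

definition free_lie_rel :: "('n magma \<Rightarrow>\<^sub>0 'k::field) \<Rightarrow> ('n magma \<Rightarrow>\<^sub>0 'k) \<Rightarrow> bool" where
  "free_lie_rel x y \<longleftrightarrow> x - y \<in> free_magma_algebra.ideal hull free_lie_relators"

lemmas free_lie_cong =
  free_magma_algebra.ideal_congruence
    [OF free_magma_algebra.ideal_hull[of free_lie_relators], folded free_lie_rel_def]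

quotient_type (overloaded) ('n, 'k) free_lie = "'n magma \<Rightarrow>\<^sub>0 'k::field" / free_lie_rel
  by (rule equivpI) (auto intro!: reflpI sympI transpI intro: free_lie_cong(1-3))

instantiation free_lie :: (type, field) ab_group_add
begin
lift_definition zero_free_lie :: "('a, 'b) free_lie" is 0 .
lift_definition plus_free_lie :: "('a, 'b) free_lie \<Rightarrow> ('a, 'b) free_lie \<Rightarrow> ('a, 'b) free_lie"
  is "(+)" by (rule free_lie_cong(4))
lift_definition minus_free_lie :: "('a, 'b) free_lie \<Rightarrow> ('a, 'b) free_lie \<Rightarrow> ('a, 'b) free_lie"
  is "(-)" by (rule free_lie_cong(5))
lift_definition uminus_free_lie :: "('a, 'b) free_lie \<Rightarrow> ('a, 'b) free_lie"
  is uminus by (rule free_lie_cong(6))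
instance
  by standard (transfer; simp add: free_lie_cong(1) algebra_simps)+
end

lift_definition free_lie_scale :: "'k::field \<Rightarrow> ('n, 'k) free_lie \<Rightarrow> ('n, 'k) free_lie"
  is magma_scale by (rule free_lie_cong(7))

lift_definition free_lie_br ::
  "('n, 'k::field) free_lie \<Rightarrow> ('n, 'k) free_lie \<Rightarrow> ('n, 'k) free_lie"
  is magma_mult by (rule free_lie_cong(8))

lift_definition free_lie_gen :: "'n \<Rightarrow> ('n, 'k::field) free_lie"
  is "\<lambda>i. Poly_Mapping.single (Gen i) 1" .

lemma free_lie_relI: "x \<in> free_lie_relators \<Longrightarrow> free_lie_rel x 0"
  by (simp add: free_lie_rel_def hull_inc)

lemma free_lie_rel_eqI: "x = y \<Longrightarrow> free_lie_rel x y"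
  by (simp add: free_lie_cong(1))

interpretation free_lie: lie_algebra free_lie_scale free_lie_br
proof unfold_locales
  fix x y z :: "('n, 'k::field) free_lie"
  show "free_lie_br x x = 0"
    by transfer (auto intro!: free_lie_relI simp: free_lie_relators_def)
  show "free_lie_br x (free_lie_br y z) + free_lie_br y (free_lie_br z x)
      + free_lie_br z (free_lie_br x y) = 0"
    by transfer (rule free_lie_relI, unfold free_lie_relators_def, blast)
qed (transfer; rule free_lie_rel_eqI;
     simp add: free_magma_algebra.vector_space_assms free_magma_algebra.br_add_left
       free_magma_algebra.br_add_right free_magma_algebra.br_scale_left
       free_magma_algebra.br_scale_right)+


section \<open>Yang-Mills algebras\<close>

text \<open>The generators are indexed by a finite type \<open>'n\<close>, so the number of generators
  is \<open>CARD('n)\<close>.\<close>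

definition yang_mills_relators :: "('n::finite, 'k::field) free_lie set" where
  "yang_mills_relators =
     {(\<Sum>i\<in>UNIV. free_lie_br (free_lie_gen i) (free_lie_br (free_lie_gen i) (free_lie_gen j))) | j. True}"

definition yang_mills_rel :: "('n::finite, 'k::field) free_lie \<Rightarrow> ('n, 'k) free_lie \<Rightarrow> bool" where
  "yang_mills_rel x y \<longleftrightarrow> x - y \<in> free_lie.ideal hull yang_mills_relators"

lemmas yang_mills_cong =
  free_lie.ideal_congruence
    [OF free_lie.ideal_hull[of yang_mills_relators], folded yang_mills_rel_def]

quotient_type (overloaded) ('n, 'k) yang_mills = "('n::finite, 'k::field) free_lie" / yang_mills_rel
  by (rule equivpI) (auto intro!: reflpI sympI transpI intro: yang_mills_cong(1-3))

instantiation yang_mills :: (finite, field) ab_group_add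
begin
lift_definition zero_yang_mills :: "('a, 'b) yang_mills" is 0 .
lift_definition plus_yang_mills ::
  "('a, 'b) yang_mills \<Rightarrow> ('a, 'b) yang_mills \<Rightarrow> ('a, 'b) yang_mills"
  is "(+)" by (rule yang_mills_cong(4))
lift_definition minus_yang_mills ::
  "('a, 'b) yang_mills \<Rightarrow> ('a, 'b) yang_mills \<Rightarrow> ('a, 'b) yang_mills"
  is "(-)" by (rule yang_mills_cong(5))
lift_definition uminus_yang_mills :: "('a, 'b) yang_mills \<Rightarrow> ('a, 'b) yang_mills"
  is uminus by (rule yang_mills_cong(6))
instance
  by standard (transfer; simp add: yang_mills_cong(1) algebra_simps)+
end

lift_definition yang_mills_scale ::
  "'k::field \<Rightarrow> ('n::finite, 'k) yang_mills \<Rightarrow> ('n, 'k) yang_mills"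
  is free_lie_scale by (rule yang_mills_cong(7))

lift_definition yang_mills_br ::
  "('n::finite, 'k::field) yang_mills \<Rightarrow> ('n, 'k) yang_mills \<Rightarrow> ('n, 'k) yang_mills"
  is free_lie_br by (rule yang_mills_cong(8))

lemma yang_mills_rel_eqI: "x = y \<Longrightarrow> yang_mills_rel x y"
  by (simp add: yang_mills_cong(1))

interpretation yang_mills: lie_algebra yang_mills_scale yang_mills_br
  by unfold_locales
    (transfer; rule yang_mills_rel_eqI;
     simp add: free_lie.vector_space_assms free_lie.br_add_left free_lie.br_add_right
       free_lie.br_scale_left free_lie.br_scale_right free_lie.alternating free_lie.jacobi)+

end

theory Submission
  imports Defs
begin

text \<open>Sending the first four generators to \<open>u, \<iota> u, v, \<iota> v\<close> with \<open>\<iota>\<^sup>2 = -1\<close> and the others to 0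
  kills every Yang-Mills relator, so it suffices that a semisimple Lie algebra is generated by two
  elements \<open>u, v\<close>. Take \<open>u\<close> in a Cartan subalgebra \<open>H\<close> separating the weights and \<open>v\<close> the sum of one
  vector from each root space: the subalgebra generated by them contains every component of \<open>v\<close>,
  hence every root space, as these are one-dimensional, hence everything, as the algebra is perfect.
  The structure theory is obtained from traces alone. On a generalized weight space the trace of
  \<open>ad h\<close> is a multiple of the weight, so in characteristic 0 weights are linear and vanish on \<open>[H, H]\<close>.
  That commutators have trace zero on \<open>\<alpha>\<close>-strings yields the nondegeneracy of the Killing form and
  the dimension of the root spaces.\<close>

section \<open>Generalized eigenspaces and traces\<close>

text \<open>The obstacle: a Cartan subalgebra \<open>H\<close> is at first only known to act
  nilpotently on itself, so common eigenvectors are out of reach and weights are mere functions.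
  Hence generalized weight spaces throughout, until nondegeneracy of the Killing form makes
  \<open>H\<close> abelian. To get nondegeneracy, let R be the radical of the form. If x, y in R
  have opposite weights \<alpha>, -\<alpha>, then every weight takes a rational multiple of
  \<alpha>([x, y]) at [x, y], and the Killing square of [x, y] is \<alpha>([x, y])^2 times a sum of
  rational squares with positive multiplicities. It vanishes, so all weights vanish at [x, y]. Thus
  [R, R] is spanned by homogeneous ad-nilpotent elements. These are closed under brackets but need
  not form a subspace, which dictates the form of Engel's theorem: it gives [R, R] a nonzero centre
  unless [R, R] = 0. As semisimplicity allows no nonzero abelian ideal, R = 0.\<close>

locale fd_space = finite_dimensional_vector_space scale Basis
  for scale :: "'k::{alg_closed_field, field_char_0} \<Rightarrow> 'a::ab_group_add \<Rightarrow> 'a" (infixr \<open>*s\<close> 75)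
    and Basis :: "'a set"
begin

abbreviation endo :: "('a \<Rightarrow> 'a) \<Rightarrow> bool" where
  "endo T \<equiv> Vector_Spaces.linear scale scale T"

lemma endo_iff: "endo T \<longleftrightarrow> (\<forall>x y. T (x + y) = T x + T y) \<and> (\<forall>c x. T (c *s x) = c *s T x)"
  by (simp add: Vector_Spaces.linear_iff vector_space_axioms)

lemma endoD:
  assumes "endo T"
  shows "T (x + y) = T x + T y" "T (c *s x) = c *s T x" "T 0 = 0" "T (x - y) = T x - T y"
    "T (- x) = - T x" "T (sum g A) = (\<Sum>a\<in>A. T (g a))"
proof -
  interpret Vector_Spaces.linear scale scale T by (fact assms)
  show "T (x + y) = T x + T y" "T (c *s x) = c *s T x" "T 0 = 0" "T (x - y) = T x - T y"
    "T (- x) = - T x" "T (sum g A) = (\<Sum>a\<in>A. T (g a))"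
    by (simp_all add: add scale diff neg sum)
qed

lemma endo_span_image: "endo T \<Longrightarrow> (\<And>b. b \<in> C \<Longrightarrow> T b \<in> W) \<Longrightarrow> subspace W \<Longrightarrow> v \<in> span C \<Longrightarrow> T v \<in> W"
  by (rotate_tac 3, induction rule: span_induct_alt)
    (auto simp: endoD subspace_0 subspace_add subspace_scale)

lemma endo_funpow: "endo T \<Longrightarrow> endo (T ^^ n)"
  by (induction n) (auto simp: endo_iff)

lemma funpow_stable: "(\<And>x. x \<in> W \<Longrightarrow> T x \<in> W) \<Longrightarrow> x \<in> W \<Longrightarrow> (T ^^ n) x \<in> W"
  by (induction n) auto

lemma funpow_zero_mono:
  assumes "endo T" "(T ^^ n) v = 0" "n \<le> m"
  shows "(T ^^ m) v = 0"
proof -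
  have "(T ^^ m) v = (T ^^ (m - n)) ((T ^^ n) v)"
    using assms(3) by (metis comp_apply funpow_add le_add_diff_inverse2)
  then show ?thesis using assms endoD(3)[OF endo_funpow] by simp
qed

section \<open>Generalized eigenspace decomposition of an endomorphism\<close>

definition shift :: "('a \<Rightarrow> 'a) \<Rightarrow> 'k \<Rightarrow> 'a \<Rightarrow> 'a" where
  "shift T c = (\<lambda>v. T v - c *s v)"

definition gen_eigenspace :: "('a \<Rightarrow> 'a) \<Rightarrow> 'k \<Rightarrow> 'a set" where
  "gen_eigenspace T c = {v. \<exists>n. (shift T c ^^ n) v = 0}"

lemma endo_shift: "endo T \<Longrightarrow> endo (shift T c)"
  by (auto simp: endo_iff shift_def algebra_simps scale_right_diff_distrib)

lemma shift_0 [simp]: "shift T 0 = T"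
  by (simp add: shift_def)

lemma subspace_gen_eigenspace:
  assumes "endo T"
  shows "subspace (gen_eigenspace T c)"
proof (rule subspaceI)
  note E = endo_shift[OF assms, of c]
  note F = endoD[OF endo_funpow[OF E]]
  show "0 \<in> gen_eigenspace T c" unfolding gen_eigenspace_def by (auto intro: exI[of _ 0])
  show "x + y \<in> gen_eigenspace T c" if xy: "x \<in> gen_eigenspace T c" "y \<in> gen_eigenspace T c" for x y
  proof -
    obtain n m where "(shift T c ^^ n) x = 0" "(shift T c ^^ m) y = 0"
      using xy unfolding gen_eigenspace_def by blast
    then have "(shift T c ^^ (n + m)) (x + y) = 0"
      using funpow_zero_mono[OF E, of n x "n + m"] funpow_zero_mono[OF E, of m y "n + m"] F(1)
      by simp
    then show ?thesis unfolding gen_eigenspace_def by blast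
  qed
  show "a *s x \<in> gen_eigenspace T c" if "x \<in> gen_eigenspace T c" for a x
    using that F(2) unfolding gen_eigenspace_def by force
qed

lemma shift_stable:
  "subspace W \<Longrightarrow> (\<And>x. x \<in> W \<Longrightarrow> T x \<in> W) \<Longrightarrow> x \<in> W \<Longrightarrow> shift T c x \<in> W"
  by (simp add: shift_def subspace_diff subspace_scale)

lemma gen_eigenspace_if_shift: "shift T c v \<in> gen_eigenspace T c \<Longrightarrow> v \<in> gen_eigenspace T c"
  by (auto simp: gen_eigenspace_def funpow_swap1 intro: exI[of _ "Suc _"])

lemma shift_gen_eigenspace:
  assumes "v \<in> gen_eigenspace T c" "endo T"
  shows "shift T c v \<in> gen_eigenspace T c"
proof -
  obtain n where "(shift T c ^^ n) v = 0" using assms(1) unfolding gen_eigenspace_def by blast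
  then have "(shift T c ^^ n) (shift T c v) = 0"
    using endoD(3)[OF endo_shift[OF assms(2)]] by (metis funpow_swap1)
  then show ?thesis unfolding gen_eigenspace_def by blast
qed

text \<open>On the generalized eigenspace of \<open>d\<close>, \<open>T - c\<close> is a nilpotent
  map plus the nonzero scalar \<open>d - c\<close>, hence invertible. The induction lowers the
  nilpotency exponent: if \<open>u\<close> is a preimage of \<open>shift T d y\<close>, then
  \<open>y - u\<close> is mapped to \<open>(d - c) *s y\<close>.\<close>

lemma gen_eigenspace_shift_surj:
  assumes T: "endo T" and W: "subspace W" "\<And>x. x \<in> W \<Longrightarrow> T x \<in> W" and "c \<noteq> d"
  shows "y \<in> W \<Longrightarrow> (shift T d ^^ n) y = 0 \<Longrightarrow> \<exists>u\<in>W \<inter> gen_eigenspace T d. shift T c u = y"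
proof (induction n arbitrary: y)
  case 0
  have "0 \<in> W \<inter> gen_eigenspace T d" using W(1) subspace_gen_eigenspace[OF T]
      by (simp add: subspace_0)
  then show ?case using 0 endoD(3)[OF endo_shift[OF T]] by auto
next
  case (Suc n)
  have "shift T d y \<in> W" using shift_stable[OF W Suc.prems(1)] .
  moreover have "(shift T d ^^ n) (shift T d y) = 0"
    using Suc.prems(2) by (simp add: funpow_swap1)
  ultimately obtain u where u: "u \<in> W \<inter> gen_eigenspace T d" "shift T c u = shift T d y"
    using Suc.IH by blast
  let ?w = "inverse (d - c) *s (y - u)"
  have y: "y \<in> W \<inter> gen_eigenspace T d" using Suc.prems unfolding gen_eigenspace_def by blast
  have "?w \<in> W \<inter> gen_eigenspace T d"
    using u(1) y W(1) subspace_gen_eigenspace[OF T, of d]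
        by (auto intro!: subspace_scale subspace_diff)
  moreover have "shift T c (y - u) = (d - c) *s y"
    using u(2) by (simp add: endoD(4)[OF endo_shift[OF T]]) (simp add: shift_def algebra_simps)
  then have "shift T c ?w = y"
    using \<open>c \<noteq> d\<close> by (simp add: endoD(2)[OF endo_shift[OF T]])
  ultimately show ?case by blast
qed

text \<open>On an eigenvector for \<open>d\<close>, \<open>shift T c\<close> is multiplication by
  \<open>d - c \<noteq> 0\<close>, so no power of it can vanish unless the vector does. Powers of
  \<open>shift T d\<close> stay in the generalized eigenspace of \<open>c\<close>, so the exponent
  \<open>n\<close> can be lowered one by one.\<close>

lemma gen_eigenspace_shift_inj:
  assumes T: "endo T" and "c \<noteq> d" "v \<in> gen_eigenspace T c" "(shift T d ^^ n) v = 0"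
  shows "v = 0"
proof -
  have "\<lbrakk>v \<in> gen_eigenspace T c; shift T d v = 0\<rbrakk> \<Longrightarrow> v = 0" for v
  proof -
    assume v: "v \<in> gen_eigenspace T c" "shift T d v = 0"
    have "T v = d *s v" using v(2) by (simp add: shift_def)
    then have e: "shift T c v = (d - c) *s v" by (simp add: shift_def algebra_simps)
    have "(shift T c ^^ n) v = (d - c) ^ n *s v" for n
      by (induction n) (simp_all add: endoD(2)[OF endo_shift[OF T]] e mult.commute)
    then show "v = 0" using v(1) \<open>c \<noteq> d\<close> unfolding gen_eigenspace_def by auto
  qed
  note inj = this
  have "endo T \<Longrightarrow> v \<in> gen_eigenspace T c \<Longrightarrow> shift T d v \<in> gen_eigenspace T c" for v
    using shift_gen_eigenspace[of v T c] subspace_gen_eigenspace[OF T, of c]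
    by (simp add: shift_def)
       (metis subspace_diff subspace_scale subspace_add diff_add_cancel)
  then have st: "v \<in> gen_eigenspace T c \<Longrightarrow> (shift T d ^^ n) v \<in> gen_eigenspace T c" for v n
    using T by (intro funpow_stable) auto
  show ?thesis using assms(3,4)
    by (induction n) (auto intro: inj st)
qed

text \<open>Linear factors of \<open>p\<close> are split off one at a time; \<open>Z\<close> is any
  set to which membership passes from \<open>(T - c) v\<close> back to \<open>v\<close>.\<close>

lemma poly_annihilate_induct:
  assumes T: "endo T" and W: "subspace W" "\<And>x. x \<in> W \<Longrightarrow> T x \<in> W" "0 \<in> Z"
    and Z: "\<And>v c. v \<in> W \<Longrightarrow> shift T c v \<in> Z \<Longrightarrow> v \<in> Z"
  shows "p \<noteq> 0 \<Longrightarrow> degree p = n \<Longrightarrow> v \<in> W \<Longrightarrow> (\<Sum>i\<le>n. coeff p i *s (T ^^ i) v) = 0 \<Longrightarrow> v \<in> Z"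
proof (induction n arbitrary: p v)
  case 0
  then have "coeff p 0 \<noteq> 0" by (metis leading_coeff_0_iff)
  then show ?case using 0 W by simp
next
  case (Suc n)
  obtain c where "poly p c = 0"
    using alg_closed_imp_poly_has_root[of p] Suc.prems by auto
  then obtain q where p: "p = [:-c, 1:] * q"
    by (auto simp: poly_eq_0_iff_dvd)
  have q: "q \<noteq> 0" using Suc.prems p by auto
  then have deg: "degree q = n"
    using Suc.prems(2) unfolding p by (subst (asm) degree_mult_eq) auto
  \<comment> \<open>With \<open>p = (X - c) q\<close>, applying \<open>p(T)\<close> to
    \<open>v\<close> is applying \<open>q(T)\<close> to \<open>(T - c) v\<close>.\<close>
  have "(\<Sum>i\<le>Suc n. coeff p i *s (T ^^ i) v)
      = (\<Sum>i\<le>Suc n. coeff (pCons 0 q) i *s (T ^^ i) v) - (\<Sum>i\<le>Suc n. (c * coeff q i) *s (T ^^ i) v)"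
    unfolding sum_subtractf[symmetric] by (simp add: p scale_left_diff_distrib)
  also have "(\<Sum>i\<le>Suc n. coeff (pCons 0 q) i *s (T ^^ i) v) = (\<Sum>i\<le>n. coeff q i *s (T ^^ i) (T v))"
    by (subst sum.atMost_Suc_shift) (simp add: funpow_swap1)
  also have "(\<Sum>i\<le>Suc n. (c * coeff q i) *s (T ^^ i) v) = (\<Sum>i\<le>n. coeff q i *s (T ^^ i) (c *s v))"
    using deg by (simp add: coeff_eq_0 endoD(2)[OF endo_funpow[OF T]] mult.commute)
  also have "(\<Sum>i\<le>n. coeff q i *s (T ^^ i) (T v)) - \<dots> = (\<Sum>i\<le>n. coeff q i *s (T ^^ i) (shift T c v))"
    unfolding sum_subtractf[symmetric]
    by (simp add: shift_def endoD(4)[OF endo_funpow[OF T]] scale_right_diff_distrib)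
  finally have "(\<Sum>i\<le>n. coeff q i *s (T ^^ i) (shift T c v)) = 0"
    using Suc.prems by simp
  moreover have "shift T c v \<in> W"
    by (rule shift_stable) (use W Suc.prems(3) in auto)
  ultimately have "shift T c v \<in> Z"
    using Suc.IH[OF q deg] by blast
  then show ?case using Z Suc.prems(3) by blast
qed

lemma ex_annihilating_poly:
  "\<exists>p. p \<noteq> 0 \<and> (\<Sum>i\<le>degree p. coeff p i *s (T ^^ i) v) = 0"
proof -
  let ?d = "dimension" and ?f = "\<lambda>i. (T ^^ i) v"
  have "\<exists>a. (\<exists>i\<le>?d. a i \<noteq> 0) \<and> (\<Sum>i\<le>?d. a i *s ?f i) = 0"
  proof (cases "inj_on ?f {..?d}")
    case True
    have "card (?f ` {..?d}) = Suc ?d" using True by (simp add: card_image)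
    then have "dependent (?f ` {..?d})"
      using dim_subset_UNIV[of "?f ` {..?d}"] by (intro dependent_biggerset_general) simp
    then obtain u where u: "\<exists>w\<in>?f ` {..?d}. u w \<noteq> 0" "(\<Sum>w\<in>?f ` {..?d}. u w *s w) = 0"
      by (subst (asm) dependent_finite) auto
    then show ?thesis
      by (intro exI[of _ "\<lambda>i. u (?f i)"]) (auto simp: sum.reindex[OF True])
  next
    case False
    then obtain i j where ij: "i \<le> ?d" "j \<le> ?d" "i \<noteq> j" "?f i = ?f j"
      by (auto simp: inj_on_def)
    \<comment> \<open>A repetition among the \<open>dimension + 1\<close> iterates is invisible to
      dependence of the set of iterates, but gives the relation with coefficients 1 and -1
      directly.\<close>
    let ?a = "\<lambda>l. (if l = i then 1 else 0) - (if l = j then 1 else (0::'k))"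
    have "(\<Sum>l\<le>?d. ?a l *s ?f l)
        = (\<Sum>l\<le>?d. if l = i then ?f l else 0) - (\<Sum>l\<le>?d. if l = j then ?f l else 0)"
      unfolding sum_subtractf[symmetric] by (intro sum.cong) (auto simp: scale_left_diff_distrib)
    also have "\<dots> = 0" using ij by simp
    finally show ?thesis using ij by (intro exI[of _ ?a]) (auto intro!: exI[of _ i])
  qed
  then obtain a i where a: "i \<le> ?d" "a i \<noteq> 0" "(\<Sum>i\<le>?d. a i *s ?f i) = 0" by blast
  define p where "p = (\<Sum>i\<le>?d. monom (a i) i)"
  have c: "coeff p i = (if i \<le> ?d then a i else 0)" for i
    by (simp add: p_def coeff_sum if_distrib cong: if_cong)
  have "p \<noteq> 0" using c[of i] a by auto
  moreover have "degree p \<le> ?d" by (rule degree_le) (auto simp: c)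
  then have "(\<Sum>i\<le>degree p. coeff p i *s ?f i) = (\<Sum>i\<le>?d. coeff p i *s ?f i)"
    by (intro sum.mono_neutral_left) (auto simp: coeff_eq_0)
  moreover have "\<dots> = 0" using a(3) by (simp add: c)
  ultimately show ?thesis by auto
qed

lemma gen_eigenspace_decomp:
  assumes T: "endo T" and W: "subspace W" "\<And>x. x \<in> W \<Longrightarrow> T x \<in> W"
  shows "W \<subseteq> span (\<Union>c. W \<inter> gen_eigenspace T c)"
proof
  fix v assume v: "v \<in> W"
  let ?Z = "span (\<Union>c. W \<inter> gen_eigenspace T c)"
  \<comment> \<open>The components of \<open>shift T c v\<close> for eigenvalues
    \<open>d \<noteq> c\<close> have preimages in \<open>?Z\<close>. Subtracting these from
    \<open>v\<close> leaves a vector that \<open>T - c\<close> sends into the generalized eigenspace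
    of \<open>c\<close>, so it lies in that space itself.\<close>
  have step: "v \<in> ?Z" if "v \<in> W" "shift T c v \<in> ?Z" for v c
  proof -
    have "\<exists>u\<in>?Z \<inter> W. y - shift T c u \<in> W \<inter> gen_eigenspace T c" if "y \<in> ?Z" for y
      using that
    proof (induction rule: span_induct_alt)
      case base
      then show ?case
        using subspace_0[OF W(1)] subspace_0[OF subspace_gen_eigenspace[OF T]]
        by (intro bexI[of _ 0]) (auto simp: span_zero endoD[OF endo_shift[OF T]])
    next
      case (step a x y)
      then obtain d u where d: "x \<in> W" "x \<in> gen_eigenspace T d"
        and u: "u \<in> ?Z \<inter> W" "y - shift T c u \<in> W \<inter> gen_eigenspace T c" by blast
      have "\<exists>w\<in>?Z \<inter> W. x - shift T c w \<in> W \<inter> gen_eigenspace T c"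
      proof (cases "c = d")
        case True
        then show ?thesis using d W(1)
          by (intro bexI[of _ 0]) (auto simp: span_zero endoD[OF endo_shift[OF T]] subspace_0)
      next
        case False
        obtain w where "w \<in> W \<inter> gen_eigenspace T d" "shift T c w = x"
          using gen_eigenspace_shift_surj[OF T W False d(1)] d(2) unfolding gen_eigenspace_def
              by blast
        then show ?thesis
          using subspace_0[OF W(1)] subspace_0[OF subspace_gen_eigenspace[OF T]]
          by (intro bexI[of _ w]) (auto intro: span_base)
      qed
      then obtain w where w: "w \<in> ?Z \<inter> W" "x - shift T c w \<in> W \<inter> gen_eigenspace T c" by blast
      have "a *s x + y - shift T c (a *s w + u) = a *s (x - shift T c w) + (y - shift T c u)"
        by (simp add: endoD[OF endo_shift[OF T]] scale_right_diff_distrib)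
      moreover have "\<dots> \<in> W \<inter> gen_eigenspace T c"
        using u w W(1) subspace_gen_eigenspace[OF T, of c]
            by (auto intro!: subspace_add subspace_scale)
      moreover have "a *s w + u \<in> ?Z \<inter> W"
        using u w W(1) by (auto intro!: span_add span_scale subspace_add subspace_scale)
      ultimately show ?case by metis
    qed
    then obtain u where u: "u \<in> ?Z" "u \<in> W" "shift T c v - shift T c u \<in> gen_eigenspace T c"
      using \<open>shift T c v \<in> ?Z\<close> by blast
    then have "v - u \<in> gen_eigenspace T c"
      using gen_eigenspace_if_shift[of T c "v - u"] by (simp add: endoD[OF endo_shift[OF T]])
    moreover have "v - u \<in> W" using \<open>v \<in> W\<close> u W(1) by (simp add: subspace_diff)
    ultimately have "v - u \<in> ?Z" by (auto intro: span_base)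
    then show ?thesis using span_add[OF _ u(1)] by force
  qed
  obtain p where p: "p \<noteq> 0" "(\<Sum>i\<le>degree p. coeff p i *s (T ^^ i) v) = 0"
    using ex_annihilating_poly by metis
  show "v \<in> ?Z"
    by (rule poly_annihilate_induct[OF T W span_zero step p(1) refl v p(2)])
qed

text \<open>The kernels of the powers of \<open>T\<close> grow strictly up to the least exponent
  killing \<open>v\<close>, which is therefore at most \<open>dimension\<close>. The uniform
  exponent lets nilpotency be treated as a polynomial identity in \<open>ex_cartan\<close>.\<close>

lemma funpow_zero_dim:
  assumes T: "endo T" and v: "(T ^^ m) v = 0"
  shows "(T ^^ dimension) v = 0"
proof (rule ccontr)
  assume nz: "(T ^^ dimension) v \<noteq> 0"
  define n where "n = (LEAST m. (T ^^ m) v = 0)"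
  have n: "(T ^^ n) v = 0" and least: "\<And>m. m < n \<Longrightarrow> (T ^^ m) v \<noteq> 0"
    unfolding n_def using v by (auto intro: LeastI dest: not_less_Least)
  have "dimension < n" using nz n funpow_zero_mono[OF T n, of dimension] by (meson not_less)
  let ?K = "\<lambda>i. {x. (T ^^ i) x = 0}"
  have sub: "subspace (?K i)" for i
    using endoD[OF endo_funpow[OF T]] by (intro subspaceI) auto
  have "i \<le> n \<Longrightarrow> i \<le> dim (?K i)" for i
  proof (induction i)
    case (Suc i)
    let ?x = "(T ^^ (n - Suc i)) v"
    have 1: "(T ^^ i) ?x = (T ^^ (n - 1)) v" "(T ^^ (Suc i)) ?x = (T ^^ n) v"
      using Suc.prems funpow_add[of i "n - Suc i" T] funpow_add[of "Suc i" "n - Suc i" T]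
          by simp_all
    then have "?x \<in> ?K (Suc i) - ?K i" using n least[of "n - 1"] Suc.prems
        by (auto simp del: funpow.simps)
    moreover have "?K i \<subseteq> ?K (Suc i)" using endoD(3)[OF T] by auto
    ultimately have "?K i \<subset> ?K (Suc i)" by blast
    then have "dim (?K i) < dim (?K (Suc i))"
      using sub[of i] sub[of "Suc i"] by (intro dim_psubset) (simp only: span_eq_iff[THEN iffD2])
    then show ?case using Suc by linarith
  qed simp
  then show False using dim_subset_UNIV[of "?K n"] \<open>dimension < n\<close>
      by (meson le_refl not_le order_trans)
qed


section \<open>Traces on invariant subspaces\<close>

definition trace_on :: "'a set \<Rightarrow> ('a \<Rightarrow> 'a) \<Rightarrow> 'k" where
  "trace_on C T = (\<Sum>b\<in>C. representation C (T b) b)"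

text \<open>Vectors outside \<open>span C\<close> have zero \<open>representation\<close>, so
  additivity needs \<open>S\<close> and \<open>T\<close> to map \<open>C\<close> into
  \<open>span C\<close>.\<close>

lemma trace_on_add:
  assumes "independent C" "\<And>b. b \<in> C \<Longrightarrow> S b \<in> span C" "\<And>b. b \<in> C \<Longrightarrow> T b \<in> span C"
  shows "trace_on C (\<lambda>v. S v + T v) = trace_on C S + trace_on C T"
  by (simp add: trace_on_def representation_add assms sum.distrib)

lemma trace_on_scale:
  assumes "independent C" "\<And>b. b \<in> C \<Longrightarrow> T b \<in> span C"
  shows "trace_on C (\<lambda>v. c *s T v) = c * trace_on C T"
  by (simp add: trace_on_def representation_scale assms sum_distrib_left)

lemma trace_on_diff:
  assumes "independent C" "\<And>b. b \<in> C \<Longrightarrow> S b \<in> span C" "\<And>b. b \<in> C \<Longrightarrow> T b \<in> span C"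
  shows "trace_on C (\<lambda>v. S v - T v) = trace_on C S - trace_on C T"
  by (simp add: trace_on_def representation_diff assms sum_subtractf)

lemma trace_on_scalar:
  assumes "independent C"
  shows "trace_on C (\<lambda>v. c *s v) = c * of_nat (card C)"
proof -
  have "trace_on C (\<lambda>v. c *s v) = (\<Sum>b\<in>C. c)"
    unfolding trace_on_def using assms
    by (intro sum.cong refl) (simp add: representation_scale span_base representation_basis)
  then show ?thesis by (simp add: mult.commute)
qed

lemma trace_on_cong: "(\<And>b. b \<in> C \<Longrightarrow> S b = T b) \<Longrightarrow> trace_on C S = trace_on C T"
  by (simp add: trace_on_def)

lemma representation_apply:
  assumes T: "endo T" and C: "independent C" "independent D" "v \<in> span C" "\<And>b. b \<in> C \<Longrightarrow> T b \<in> span D"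
  shows "representation D (T v) c = (\<Sum>b\<in>C. representation C v b * representation D (T b) c)"
proof -
  have fin: "finite C" using C finiteI_independent by blast
  have "T v = T (\<Sum>b\<in>C. representation C v b *s b)"
    using sum_representation_eq[of C v C] C fin by simp
  also have "\<dots> = (\<Sum>b\<in>C. representation C v b *s T b)"
    by (simp add: endoD[OF T])
  finally show ?thesis using C by (simp add: representation_sum span_scale representation_scale)
qed

text \<open>Both sides equal \<open>\<Sum>b\<in>C. \<Sum>d\<in>D. b\<^sup>*(S d) d\<^sup>*(T b)\<close>; the case \<open>S = id\<close> is
  independence of the basis.\<close>

lemma trace_on_commute_bases:
  assumes S: "endo S" and T: "endo T" and C: "independent C" and D: "independent D"
    and "\<And>b. b \<in> C \<Longrightarrow> T b \<in> span D" and "\<And>d. d \<in> D \<Longrightarrow> S d \<in> span C"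
  shows "trace_on C (\<lambda>v. S (T v)) = trace_on D (\<lambda>v. T (S v))"
proof -
  have "trace_on C (\<lambda>v. S (T v))
      = (\<Sum>b\<in>C. \<Sum>d\<in>D. representation D (T b) d * representation C (S d) b)"
    unfolding trace_on_def using assms by (intro sum.cong refl representation_apply) auto
  also have "\<dots> = (\<Sum>d\<in>D. \<Sum>b\<in>C. representation C (S d) b * representation D (T b) d)"
    by (subst sum.swap) (simp add: mult.commute)
  also have "\<dots> = trace_on D (\<lambda>v. T (S v))"
    unfolding trace_on_def using assms by (intro sum.cong refl representation_apply[symmetric]) auto
  finally show ?thesis .
qed

lemma endo_id: "endo (\<lambda>v. v)"
  by (simp add: endo_iff)

lemma trace_on_basis_change:
  assumes "endo T" "independent C" "independent D" "span C = span D" "\<And>b. b \<in> C \<Longrightarrow> T b \<in> span C"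
  shows "trace_on C T = trace_on D T"
  using trace_on_commute_bases[OF endo_id, of T C D] assms by (auto intro: span_base)

lemma trace_on_commute:
  assumes "endo S" "endo T" "independent C" "\<And>b. b \<in> C \<Longrightarrow> T b \<in> span C" "\<And>b. b \<in> C \<Longrightarrow> S b \<in> span C"
  shows "trace_on C (\<lambda>v. S (T v)) = trace_on C (\<lambda>v. T (S v))"
  using trace_on_commute_bases[of S T C C] assms by blast

text \<open>By nilpotency the image of \<open>span C\<close> is a proper subspace. In a basis of
  \<open>span C\<close> extending one of the image, only vectors of the image basis contribute to
  the diagonal, so the trace equals that of \<open>T\<close> on the smaller space.\<close>

lemma trace_on_nilpotent:
  assumes T: "endo T"
  shows "independent C \<Longrightarrow> (\<And>b. b \<in> C \<Longrightarrow> T b \<in> span C) \<Longrightarrow> (\<And>b. b \<in> C \<Longrightarrow> b \<in> gen_eigenspace T 0) \<Longrightarrow>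
      trace_on C T = 0"
proof (induction "card C" arbitrary: C rule: less_induct)
  case less
  note C = less.prems
  have nil: "(T ^^ dimension) v = 0" if "v \<in> span C" for v
  proof -
    have "v \<in> gen_eigenspace T 0"
        using that span_minimal[OF _ subspace_gen_eigenspace[OF T], of C 0] C(3) by blast
    then show ?thesis using funpow_zero_dim[OF T] unfolding gen_eigenspace_def by auto
  qed
  have st: "T v \<in> span C" if "v \<in> span C" for v
    using endo_span_image[OF T C(2) _ that] by blast
  show ?case
  proof (cases "C = {}")
    case False
    let ?W = "T ` span C"
    interpret L: Vector_Spaces.linear scale scale T by (fact T)
    have sW: "subspace ?W" by (rule L.subspace_image) simp
    have WC: "?W \<subseteq> span C" using st by blast
    have ne: "?W \<noteq> span C"
    proof
      assume eq: "?W = span C"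
      have "(T ^^ n) ` span C = span C" for n
      proof (induction n)
        case (Suc n)
        have "(T ^^ Suc n) ` span C = T ` ((T ^^ n) ` span C)" by (auto simp: image_comp)
        then show ?case using Suc eq by simp
      qed simp
      then have "span C = (T ^^ dimension) ` span C" by simp
      also have "\<dots> \<subseteq> {0}" using nil by auto
      finally have "C \<subseteq> {0}" using span_superset by blast
      then show False using C(1) False dependent_zero by blast
    qed
    obtain B' where B': "B' \<subseteq> ?W" "independent B'" "span B' = ?W" "card B' = dim ?W"
      by (rule basis_subspace_exists[OF sW]) (rule that)
    obtain B where B: "B' \<subseteq> B" "B \<subseteq> span C" "independent B" "span C \<subseteq> span B"
      by (rule maximal_independent_subset_extend[OF order.trans[OF B'(1) WC] B'(2)]) (rule that)
    have sB: "span B = span C"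
      using B(2,4) span_minimal[OF B(2)] by auto
    have finB: "finite B" using B(3) finiteI_independent by blast
    have "dim ?W < dim (span C)"
      using sW WC ne by (intro dim_psubset) (auto simp: span_eq_iff[THEN iffD2] span_span)
    then have "card B' < card C"
      using B'(4) C(1) by (simp add: dim_eq_card_independent)
    then have IH: "trace_on B' T = 0"
    proof (rule less.hyps[OF _ B'(2)])
      show "b \<in> gen_eigenspace T 0" if "b \<in> B'" for b
        using that B'(1) WC nil unfolding gen_eigenspace_def by force
      show "T b \<in> span B'" if "b \<in> B'" for b
        using that B'(1,3) WC by (metis imageI subsetD)
    qed
    have inB': "T b \<in> span B'" if "b \<in> B" for b using that B(2) B'(3) by blast
    have rep: "representation B (T b) = representation B' (T b)" if "b \<in> B" for b
      by (rule representation_extend[OF B(3) inB'[OF that] B(1)])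
    have "trace_on C T = trace_on B T"
      using trace_on_basis_change[OF T C(1) B(3)] sB C(2) by simp
    also have "\<dots> = (\<Sum>b\<in>B. representation B' (T b) b)"
      by (simp add: trace_on_def rep)
    also have "\<dots> = (\<Sum>b\<in>B'. representation B' (T b) b)"
      using finB B(1) by (intro sum.mono_neutral_right) (auto dest: representation_ne_zero)
    also have "\<dots> = 0" using IH by (simp add: trace_on_def)
    finally show ?thesis .
  qed (simp add: trace_on_def)
qed

text \<open>\<open>T = N + c\<close> with \<open>N\<close> nilpotent, so
  \<open>T^2 = N^2 + 2 c N + c^2\<close>, where \<open>N\<close> and \<open>N^2\<close> have trace
  zero. The second formula serves the Killing form on \<open>H\<close>.\<close>

lemma trace_on_single_eigenvalue:
  assumes T: "endo T" and C: "independent C" "\<And>b. b \<in> C \<Longrightarrow> T b \<in> span C" "\<And>b. b \<in> C \<Longrightarrow>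
      b \<in> gen_eigenspace T c"
  shows "trace_on C T = c * of_nat (card C)"
    and "trace_on C (\<lambda>v. T (T v)) = c\<^sup>2 * of_nat (card C)"
proof -
  let ?N = "shift T c"
  have eN: "endo ?N" by (rule endo_shift[OF T])
  have NC: "?N v \<in> span C" if "v \<in> span C" for v
    using shift_stable[of "span C" T v c] endo_span_image[OF T C(2)] that by auto
  have z: "trace_on C ?N = 0"
    using C by (intro trace_on_nilpotent eN NC span_base) (auto simp: gen_eigenspace_def)
  have z2: "trace_on C (\<lambda>v. ?N (?N v)) = 0"
  proof (rule trace_on_nilpotent)
    show "endo (\<lambda>v. ?N (?N v))" using eN by (auto simp: endo_iff)
    fix b assume b: "b \<in> C"
    show "?N (?N b) \<in> span C" using b by (simp add: NC span_base)
    obtain n where n: "(?N ^^ n) b = 0" using C(3)[OF b] unfolding gen_eigenspace_def by blast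
    have "((\<lambda>v. ?N (?N v)) ^^ m) w = (?N ^^ (2 * m)) w" for m w
      by (induction m) auto
    then have "((\<lambda>v. ?N (?N v)) ^^ n) b = 0"
      using funpow_zero_mono[OF eN n, of "2 * n"] by simp
    then show "b \<in> gen_eigenspace (\<lambda>v. ?N (?N v)) 0" unfolding gen_eigenspace_def by auto
  qed (fact C)
  have "trace_on C T = trace_on C (\<lambda>v. ?N v + c *s v)" by (rule trace_on_cong) (simp add: shift_def)
  also have "\<dots> = c * of_nat (card C)"
    using C by (subst trace_on_add) (auto simp: NC span_base span_scale z trace_on_scalar)
  finally show "trace_on C T = c * of_nat (card C)" .
  have "T (T v) = ?N (?N v) + (c + c) *s ?N v + c\<^sup>2 *s v" for v
  proof -
    have "T (T v) = T (?N v) + c *s T v" by (simp add: shift_def endoD[OF T])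
    moreover have "T (?N v) = ?N (?N v) + c *s ?N v" "c *s T v = c *s ?N v + c\<^sup>2 *s v"
      by (simp_all add: shift_def scale_right_diff_distrib power2_eq_square)
    ultimately show ?thesis by (simp only: scale_left_distrib add.assoc)
  qed
  then have "trace_on C (\<lambda>v. T (T v)) = trace_on C (\<lambda>v. ?N (?N v) + (c + c) *s ?N v + c\<^sup>2 *s v)"
    by simp
  also have "\<dots> = trace_on C (\<lambda>v. ?N (?N v) + (c + c) *s ?N v) + trace_on C (\<lambda>v. c\<^sup>2 *s v)"
    using C by (intro trace_on_add) (auto intro!: span_add span_scale simp: NC span_base)
  also have "\<dots> = trace_on C (\<lambda>v. ?N (?N v)) + (c + c) * trace_on C ?N + c\<^sup>2 * of_nat (card C)"
    using C by (subst trace_on_add) (auto intro!: span_scale simp: NC span_base trace_on_scalar trace_on_scale[of C ?N])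
  finally show "trace_on C (\<lambda>v. T (T v)) = c\<^sup>2 * of_nat (card C)"
    using z z2 by simp
qed

lemma trace_on_Union:
  assumes "finite F" "independent (\<Union>(C ` F))" "\<And>i j. i \<in> F \<Longrightarrow> j \<in> F \<Longrightarrow> i \<noteq> j \<Longrightarrow> C i \<inter> C j = {}"
    and "\<And>i b. i \<in> F \<Longrightarrow> b \<in> C i \<Longrightarrow> T b \<in> span (C i)"
  shows "trace_on (\<Union>(C ` F)) T = (\<Sum>i\<in>F. trace_on (C i) T)"
proof -
  have "trace_on (\<Union>(C ` F)) T = (\<Sum>i\<in>F. \<Sum>b\<in>C i. representation (\<Union>(C ` F)) (T b) b)"
    unfolding trace_on_def
  proof (rule sum.UNION_disjoint)
    show "\<forall>i\<in>F. finite (C i)"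
      using finiteI_independent[OF assms(2)] by (meson UN_upper finite_subset)
  qed (use assms in auto)
  also have "\<dots> = (\<Sum>i\<in>F. trace_on (C i) T)"
    unfolding trace_on_def
    by (intro sum.cong refl, subst representation_extend[OF assms(2)]) (use assms in auto)
  finally show ?thesis .
qed

end

section \<open>Weight spaces\<close>

locale fd_lie = lie_algebra scale br + fd_space scale Basis
  for scale :: "'k::{alg_closed_field, field_char_0} \<Rightarrow> 'a::ab_group_add \<Rightarrow> 'a" (infixr \<open>*s\<close> 75)
    and br :: "'a \<Rightarrow> 'a \<Rightarrow> 'a" and Basis :: "'a set"
begin

lemma endo_br: "endo (br x)"
  by (simp add: endo_iff br_add_right br_scale_right)

lemma endo_br_left: "endo (\<lambda>x. br x y)"
  by (simp add: endo_iff br_add_left br_scale_left)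

lemmas br_right_simps = endoD[OF endo_br]
lemmas br_left_simps = endoD[OF endo_br_left]

lemma br_antisym: "br x y = - br y x"
proof -
  have "0 = br (x + y) (x + y)" by (simp add: alternating)
  also have "\<dots> = br x y + br y x"
    unfolding br_add_left br_add_right by (simp add: alternating)
  finally show ?thesis by (metis eq_neg_iff_add_eq_0)
qed

lemma br_br: "br x (br y z) = br (br x y) z + br y (br x z)"
proof -
  have "br y (br z x) = - br y (br x z)" "br z (br x y) = - br (br x y) z"
    using br_antisym[of z x] br_antisym[of z "br x y"] by (auto simp: br_right_simps)
  then show ?thesis using jacobi[of x y z] by (simp add: algebra_simps)
qed

lemma br_span_mem:
  assumes "\<And>x y. x \<in> X \<Longrightarrow> y \<in> Y \<Longrightarrow> br x y \<in> W" "subspace W" "x \<in> span X" "y \<in> span Y"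
  shows "br x y \<in> W"
proof -
  have "br x' y \<in> W" if "x' \<in> X" for x'
    using endo_span_image[OF endo_br assms(1)[OF that] assms(2,4)] by blast
  then show ?thesis
    using endo_span_image[OF endo_br_left _ assms(2,3), of y] by blast
qed

lemma shift_br: "shift (br h) (a + b) (br x y) = br (shift (br h) a x) y + br x (shift (br h) b y)"
  by (simp add: shift_def br_br[of h x y] br_left_simps br_right_simps scale_left_distrib)

text \<open>By the Leibniz rule \<open>shift_br\<close>, each application of the shifted map to a
  bracket lowers the exponent of one of the two entries; hence the induction on the sum of the
  exponents.\<close>

lemma gen_eigenspace_br:
  assumes "x \<in> gen_eigenspace (br h) a" "y \<in> gen_eigenspace (br h) b"
  shows "br x y \<in> gen_eigenspace (br h) (a + b)"
proof -
  have "(shift (br h) a ^^ n) x = 0 \<Longrightarrow> (shift (br h) b ^^ m) y = 0 \<Longrightarrow>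
      br x y \<in> gen_eigenspace (br h) (a + b)" for n m
  proof (induction "n + m" arbitrary: n m x y)
    case 0
    then show ?case by (auto simp: br_right_simps subspace_0[OF subspace_gen_eigenspace[OF endo_br]])
  next
    case (Suc k)
    show ?case
    proof (cases "n = 0 \<or> m = 0")
      case True
      then show ?thesis using Suc.prems
        by (auto simp: br_right_simps br_left_simps subspace_0[OF subspace_gen_eigenspace[OF endo_br]])
    next
      case False
      then obtain n' m' where nm: "n = Suc n'" "m = Suc m'" by (meson not0_implies_Suc)
      have "br (shift (br h) a x) y \<in> gen_eigenspace (br h) (a + b)"
        using Suc.hyps(1)[of n' m "shift (br h) a x" y] Suc.hyps(2) Suc.prems nm
        by (simp add: funpow_swap1)
      moreover have "br x (shift (br h) b y) \<in> gen_eigenspace (br h) (a + b)"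
        using Suc.hyps(1)[of n m' x "shift (br h) b y"] Suc.hyps(2) Suc.prems nm
        by (simp add: funpow_swap1)
      ultimately show ?thesis
        using gen_eigenspace_if_shift[of "br h" "a + b" "br x y"]
        by (simp add: shift_br subspace_add[OF subspace_gen_eigenspace[OF endo_br]])
    qed
  qed
  then show ?thesis using assms unfolding gen_eigenspace_def by blast
qed

text \<open>\<open>\<chi>\<close> is an arbitrary function here; that it is linear on a Cartan
  subalgebra when the space is nonzero is proved later, in \<open>weight_add\<close> and
  \<open>weight_scale\<close>.\<close>

definition weight_space :: "'a set \<Rightarrow> ('a \<Rightarrow> 'k) \<Rightarrow> 'a set" where
  "weight_space H \<chi> = {v. \<forall>h\<in>H. v \<in> gen_eigenspace (br h) (\<chi> h)}"

lemma subspace_weight_space: "subspace (weight_space H \<chi>)"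
  using subspace_gen_eigenspace[OF endo_br] unfolding weight_space_def
  by (intro subspaceI) (auto simp: subspace_0 subspace_add subspace_scale)

lemma weight_space_br: "x \<in> weight_space H \<chi> \<Longrightarrow> y \<in> weight_space H \<psi> \<Longrightarrow>
    br x y \<in> weight_space H (\<lambda>h. \<chi> h + \<psi> h)"
  by (auto simp: weight_space_def gen_eigenspace_br)

text \<open>Functions vanishing off \<open>H\<close> represent the functions on \<open>H\<close>.\<close>

definition vanishes_off :: "'a set \<Rightarrow> ('a \<Rightarrow> 'k) \<Rightarrow> bool" where
  "vanishes_off H \<chi> \<longleftrightarrow> (\<forall>x. x \<notin> H \<longrightarrow> \<chi> x = 0)"

lemma weight_space_stable: "h \<in> weight_space H (\<lambda>_. 0) \<Longrightarrow> v \<in> weight_space H \<chi> \<Longrightarrow>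
    br h v \<in> weight_space H \<chi>"
  using weight_space_br[of h H "\<lambda>_. 0" v \<chi>] by simp

text \<open>A power of \<open>shift (br h) (\<psi> h)\<close> kills the \<psi>-component, maps the
  other weight spaces to themselves and is injective on those whose weight differs from \<psi> at
  \<open>h\<close>. Thus \<open>h\<close> is chosen for the one component that is to be shown
  zero.\<close>

lemma weight_space_sum_zero:
  assumes "finite F" and H: "H \<subseteq> weight_space H (\<lambda>_. 0)"
  shows "(\<And>\<chi>. \<chi> \<in> F \<Longrightarrow> vanishes_off H \<chi>) \<Longrightarrow> (\<And>\<chi>. \<chi> \<in> F \<Longrightarrow> v \<chi> \<in> weight_space H \<chi>) \<Longrightarrow> (\<Sum>\<chi>\<in>F. v \<chi>) = 0
    \<Longrightarrow> \<chi> \<in> F \<Longrightarrow> v \<chi> = 0"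
  using assms(1)
proof (induction F arbitrary: v \<chi> rule: finite_induct)
  case (insert \<psi> F)
  have z: "v \<chi> = 0" if "\<chi> \<in> F" for \<chi>
  proof -
    have "\<chi> \<noteq> \<psi>" using that insert.hyps by blast
    then obtain h where h: "\<chi> h \<noteq> \<psi> h" by blast
    then have hH: "h \<in> H"
      using insert.prems(1)[of \<chi>] insert.prems(1)[of \<psi>] that unfolding vanishes_off_def by force
    obtain n where n: "(shift (br h) (\<psi> h) ^^ n) (v \<psi>) = 0"
      using insert.prems(2)[of \<psi>] hH unfolding weight_space_def gen_eigenspace_def by blast
    let ?S = "shift (br h) (\<psi> h) ^^ n"
    note E = endo_shift[OF endo_br]
    have "(\<Sum>\<chi>\<in>F. ?S (v \<chi>)) = ?S (\<Sum>\<chi>\<in>insert \<psi> F. v \<chi>)"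
      using insert.hyps n by (simp add: endoD[OF endo_funpow[OF E]])
    then have s: "(\<Sum>\<chi>\<in>F. ?S (v \<chi>)) = 0"
      using insert.prems(3) by (simp add: endoD[OF endo_funpow[OF E]])
    have "?S (v \<chi>) = 0"
    proof (rule insert.IH[OF _ _ s that])
      fix \<chi>' assume "\<chi>' \<in> F"
      then have "vanishes_off H \<chi>'" "v \<chi>' \<in> weight_space H \<chi>'" using insert.prems by auto
      moreover have "shift (br h) (\<psi> h) w \<in> weight_space H \<chi>'" if "w \<in> weight_space H \<chi>'" for w
        by (rule shift_stable[OF subspace_weight_space _ that]) (use H hH in \<open>auto intro: weight_space_stable\<close>)
      ultimately show "vanishes_off H \<chi>'" "?S (v \<chi>') \<in> weight_space H \<chi>'"
        by (auto intro: funpow_stable)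
    qed
    then show ?thesis
      using gen_eigenspace_shift_inj[OF endo_br h] insert.prems(2)[of \<chi>] that hH
          unfolding weight_space_def by blast
  qed
  then have "v \<psi> = 0" using insert by simp
  then show ?case using z insert.prems(4) by blast
qed simp

text \<open>Either each \<open>h \<in> H\<close> has a single generalized eigenvalue on
  \<open>W\<close>, and \<open>W\<close> lies in one weight space, or some \<open>h\<close> splits
  \<open>W\<close> into strictly smaller pieces. These are \<open>H\<close>-stable because
  \<open>br h\<close> acts nilpotently on \<open>H\<close>.\<close>

lemma weight_space_decomp:
  assumes H: "H \<subseteq> weight_space H (\<lambda>_. 0)"
  shows "subspace W \<Longrightarrow> (\<And>h w. h \<in> H \<Longrightarrow> w \<in> W \<Longrightarrow> br h w \<in> W) \<Longrightarrow>
    W \<subseteq> span (\<Union>\<chi>\<in>Collect (vanishes_off H). W \<inter> weight_space H \<chi>)"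
proof (induction "dim W" arbitrary: W rule: less_induct)
  case less
  show ?case
  proof (cases "\<forall>h\<in>H. \<exists>c. W \<subseteq> gen_eigenspace (br h) c")
    case True
    then obtain c where c: "\<And>h. h \<in> H \<Longrightarrow> W \<subseteq> gen_eigenspace (br h) (c h)" by metis
    let ?\<chi> = "\<lambda>h. if h \<in> H then c h else 0"
    have "vanishes_off H ?\<chi>" "W \<subseteq> weight_space H ?\<chi>" using c
        by (auto simp: vanishes_off_def weight_space_def)
    then have "W \<subseteq> (\<Union>\<chi>\<in>Collect (vanishes_off H). W \<inter> weight_space H \<chi>)" by blast
    then show ?thesis by (meson order.trans span_superset)
  next
    case False
    then obtain h where h: "h \<in> H" "\<And>c. \<not> W \<subseteq> gen_eigenspace (br h) c" by blast
    have "W \<inter> gen_eigenspace (br h) c \<subseteq> span (\<Union>\<chi>\<in>Collect (vanishes_off H). W \<inter> weight_space H \<chi>)" for c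
    proof -
      let ?W = "W \<inter> gen_eigenspace (br h) c"
      have sub: "subspace ?W"
          by (intro subspace_inter less.prems(1) subspace_gen_eigenspace endo_br)
      have "?W \<subset> W" using h(2) by blast
      then have "dim ?W < dim W"
        using sub less.prems(1) by (intro dim_psubset) (simp only: span_eq_iff[THEN iffD2])
      moreover have "br h' w \<in> ?W" if "h' \<in> H" "w \<in> ?W" for h' w
      proof -
        have "h' \<in> gen_eigenspace (br h) 0" using H that(1) h(1) unfolding weight_space_def by blast
        then have "br h' w \<in> gen_eigenspace (br h) (0 + c)" using that(2)
            by (intro gen_eigenspace_br) auto
        then show ?thesis using less.prems(2)[OF that(1)] that(2) by auto
      qed
      ultimately have "?W \<subseteq> span (\<Union>\<chi>\<in>Collect (vanishes_off H). ?W \<inter> weight_space H \<chi>)"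
        using less.hyps sub by blast
      also have "\<dots> \<subseteq> span (\<Union>\<chi>\<in>Collect (vanishes_off H). W \<inter> weight_space H \<chi>)"
        by (intro span_mono) blast
      finally show ?thesis .
    qed
    then have "span (\<Union>c. W \<inter> gen_eigenspace (br h) c) \<subseteq> span (\<Union>\<chi>\<in>Collect (vanishes_off H). W \<inter> weight_space H \<chi>)"
      by (intro span_minimal) auto
    then show ?thesis
      using gen_eigenspace_decomp[OF endo_br less.prems(1), of h] less.prems(2)[OF h(1)] by blast
  qed
qed

section \<open>Existence of a Cartan subalgebra\<close>

lemma family_card_le_dimension:
  assumes F: "finite F" and "\<And>u t. (\<Sum>t\<in>F. u t *s v t) = 0 \<Longrightarrow> t \<in> F \<Longrightarrow> u t = 0"
  shows "card F \<le> dimension"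
proof -
  \<comment> \<open>The hypothesis concerns an indexed family, so coinciding vectors have to be
    excluded before passing to the image set.\<close>
  have inj: "inj_on v F"
  proof (rule inj_onI, rule ccontr)
    fix s t assume st: "s \<in> F" "t \<in> F" "v s = v t" "s \<noteq> t"
    let ?u = "\<lambda>r. (if r = s then 1 else 0) - (if r = t then 1 else (0::'k))"
    have "(\<Sum>r\<in>F. ?u r *s v r) = (\<Sum>r\<in>F. if r = s then v r else 0) - (\<Sum>r\<in>F. if r = t then v r else 0)"
      unfolding sum_subtractf[symmetric] by (intro sum.cong) (auto simp: scale_left_diff_distrib)
    also have "\<dots> = 0" using st F by simp
    finally have "?u s = 0" using assms(2)[of ?u s] st(1) by blast
    then show False using st(4) by simp
  qed
  have "independent (v ` F)"
  proof (rule independent_if_scalars_zero)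
    fix f x assume "(\<Sum>x\<in>v ` F. f x *s x) = 0" "x \<in> v ` F"
    then show "f x = 0" using assms(2)[of "\<lambda>t. f (v t)"] by (auto simp: sum.reindex[OF inj])
  qed (use F in simp)
  then show ?thesis
    using independent_bound_general dim_subset_UNIV[of "v ` F"] inj
        by (metis card_image order.trans)
qed

lemma finite_if_card_bounded: "(\<And>F. F \<subseteq> A \<Longrightarrow> finite F \<Longrightarrow> card F \<le> n) \<Longrightarrow> finite A"
  by (metis infinite_arbitrarily_large not_less_eq_eq order_refl)

text \<open>Modulo \<open>H\<close>, ad \<open>a\<close> is injective and
  \<open>[h, w t] = - t [a, w t]\<close>, so the \<open>w t\<close> behave like eigenvectors of
  \<open>ad(a)^-1 ad(h)\<close> for distinct eigenvalues. Their independence modulo \<open>H\<close>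
  is the usual elimination argument, carried out without a quotient space.\<close>

lemma pencil_zero:
  assumes H: "subspace H" "\<And>v. v \<in> H \<Longrightarrow> br h v \<in> H" "\<And>v. br a v \<in> H \<Longrightarrow> v \<in> H"
  shows "finite F \<Longrightarrow> (\<And>t. t \<in> F \<Longrightarrow> br (h + t *s a) (w t) \<in> H) \<Longrightarrow> (\<Sum>t\<in>F. w t) \<in> H \<Longrightarrow> t \<in> F \<Longrightarrow> w t \<in> H"
proof (induction F arbitrary: w t rule: finite_induct)
  case (insert s F)
  let ?F = "insert s F"
  have "(\<Sum>t\<in>?F. br (h + t *s a) (w t)) - br h (\<Sum>t\<in>?F. w t) \<in> H"
    by (rule subspace_diff[OF H(1) subspace_sum[OF H(1)] H(2)]) (use insert.prems(1,2) in auto)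
  also have "(\<Sum>t\<in>?F. br (h + t *s a) (w t)) - br h (\<Sum>t\<in>?F. w t) = br a (\<Sum>t\<in>?F. t *s w t)"
    by (simp only: br_add_left br_right_simps sum_subtractf[symmetric] br_scale_left) simp
  finally have "(\<Sum>t\<in>?F. t *s w t) \<in> H" by (rule H(3))
  then have "(\<Sum>t\<in>?F. t *s w t) - s *s (\<Sum>t\<in>?F. w t) \<in> H"
    using insert.prems H(1) by (intro subspace_diff subspace_scale)
  also have "(\<Sum>t\<in>?F. t *s w t) - s *s (\<Sum>t\<in>?F. w t) = (\<Sum>t\<in>F. (t - s) *s w t)"
    using insert.hyps by (simp add: scale_left_diff_distrib sum_subtractf scale_sum_right scale_right_distrib)
  finally have IH: "(t - s) *s w t \<in> H" if "t \<in> F" for t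
    using insert.IH[of "\<lambda>t. (t - s) *s w t" t] that insert.prems(1) H(1)
    by (simp add: br_right_simps subspace_scale)
  have F: "w t \<in> H" if "t \<in> F" for t
  proof -
    have "t - s \<noteq> 0" using that insert.hyps by auto
    then show ?thesis using subspace_scale[OF H(1) IH[OF that], of "inverse (t - s)"] by simp
  qed
  moreover have "w s \<in> H"
    using subspace_diff[OF H(1) insert.prems(2), of "sum w F"] subspace_sum[OF H(1), of F w] F insert.hyps by simp
  ultimately show ?case using insert.prems(3) by blast
qed simp

text \<open>Each coordinate is a polynomial in \<open>t\<close> with infinitely many roots.\<close>

lemma vector_poly_zero:
  assumes "infinite A" "\<And>t. t \<in> A \<Longrightarrow> (\<Sum>i\<le>n. t ^ i *s u i) = 0"
  shows "u 0 = 0"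
proof -
  let ?r = "representation Basis"
  have sp: "x \<in> span Basis" for x by (simp add: span_Basis)
  have "?r (u 0) b = 0" for b
  proof -
    define p where "p = (\<Sum>i\<le>n. monom (?r (u i) b) i)"
    have "poly p t = 0" if "t \<in> A" for t
    proof -
      have "poly p t = (\<Sum>i\<le>n. t ^ i * ?r (u i) b)"
        by (simp add: p_def poly_sum poly_monom mult.commute)
      also have "\<dots> = ?r (\<Sum>i\<le>n. t ^ i *s u i) b"
        by (simp add: representation_sum representation_scale independent_Basis sp)
      finally show ?thesis using assms(2)[OF that] by (simp add: representation_zero)
    qed
    then have "p = 0" using assms(1) poly_roots_finite[of p] finite_subset[of A "{x. poly p x = 0}"]
        by blast
    then have "coeff p 0 = 0" by simp
    then show ?thesis by (simp add: p_def coeff_sum)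
  qed
  then show ?thesis
    using sum_representation_eq[OF independent_Basis sp finite_Basis order_refl, of "u 0"] by simp
qed

lemma br_pencil_poly:
  "\<exists>u. u 0 = (br h ^^ n) v \<and> (\<forall>t. (br (h + t *s a) ^^ n) v = (\<Sum>i\<le>n. t ^ i *s u i))"
proof (induction n)
  case 0
  show ?case by (intro exI[of _ "\<lambda>_. v"]) simp
next
  case (Suc n)
  then obtain u where u: "u 0 = (br h ^^ n) v" "\<And>t. (br (h + t *s a) ^^ n) v = (\<Sum>i\<le>n. t ^ i *s u i)"
    by blast
  define w where "w i = (if i \<le> n then br h (u i) else 0) + (if i = 0 then 0 else br a (u (i - 1)))" for i
  have "(br (h + t *s a) ^^ Suc n) v = (\<Sum>i\<le>Suc n. t ^ i *s w i)" for t
  proof -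
    have "(br (h + t *s a) ^^ Suc n) v
        = (\<Sum>i\<le>n. t ^ i *s br h (u i)) + (\<Sum>i\<le>n. t ^ Suc i *s br a (u i))"
      by (simp add: u br_add_left br_scale_left br_right_simps scale_sum_right scale_right_distrib sum.distrib mult.commute)
    also have "(\<Sum>i\<le>n. t ^ i *s br h (u i)) = (\<Sum>i\<le>Suc n. t ^ i *s (if i \<le> n then br h (u i) else 0))"
      by simp
    also have "(\<Sum>i\<le>n. t ^ Suc i *s br a (u i))
        = (\<Sum>i\<le>Suc n. t ^ i *s (if i = 0 then 0 else br a (u (i - 1))))"
      by (subst sum.atMost_Suc_shift) simp
    finally show ?thesis unfolding w_def scale_right_distrib sum.distrib .
  qed
  moreover have "w 0 = (br h ^^ Suc n) v" by (simp add: w_def u)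
  ultimately show ?case by blast
qed

text \<open>The equation says that \<open>H\<close> acts nilpotently on itself and contains every
  vector on which all of \<open>H\<close> acts nilpotently. \<open>H\<close> is a generalized null
  space of some ad \<open>a\<close>, of least dimension. For all but finitely many \<open>t\<close>
  the null space of ad \<open>h + t *s a\<close> lies in \<open>H\<close>, hence equals it by
  minimality. So a fixed power of ad \<open>h + t *s a\<close> kills \<open>v\<close> for infinitely
  many \<open>t\<close>, and polynomial dependence on \<open>t\<close> carries this over to
  \<open>t = 0\<close>.\<close>

lemma ex_cartan: "\<exists>H. H = weight_space H (\<lambda>_. 0)"
proof -
  obtain a where a: "\<And>b. dim (gen_eigenspace (br a) 0) \<le> dim (gen_eigenspace (br b) 0)"
    using ex_has_least_nat[of "\<lambda>_. True" _ "\<lambda>b. dim (gen_eigenspace (br b) 0)"] by blast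
  define H where "H = gen_eigenspace (br a) 0"
  have sH: "subspace H" unfolding H_def by (rule subspace_gen_eigenspace[OF endo_br])
  have brH: "br x y \<in> H" if "x \<in> H" "y \<in> H" for x y
    using gen_eigenspace_br[of x a 0 y 0] that by (simp add: H_def)
  have aH: "a \<in> H" unfolding H_def gen_eigenspace_def
      by (auto intro!: exI[of _ 1] simp: alternating)
  have inH: "v \<in> H" if "br a v \<in> H" for v
    using that gen_eigenspace_if_shift[of "br a" 0 v] by (simp add: H_def)
  have "(br h ^^ dimension) v = 0" if h: "h \<in> H" and v: "v \<in> H" for h v
  proof -
    \<comment> \<open>The exceptional \<open>t\<close>, for which \<open>h + t *s a\<close> is not
      injective modulo \<open>H\<close>; by \<open>pencil_zero\<close> witnesses for distinct
      \<open>t\<close> are independent.\<close>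
    let ?B = "{t. \<exists>v. v \<notin> H \<and> br (h + t *s a) v \<in> H}"
    have "finite ?B"
    proof (rule finite_if_card_bounded)
      fix F assume F: "F \<subseteq> ?B" "finite F"
      then obtain w where w: "\<And>t. t \<in> F \<Longrightarrow> w t \<notin> H" "\<And>t. t \<in> F \<Longrightarrow> br (h + t *s a) (w t) \<in> H"
        by (simp add: subset_iff) metis
      show "card F \<le> dimension"
      proof (rule family_card_le_dimension[OF F(2), of w])
        fix u t assume u: "(\<Sum>t\<in>F. u t *s w t) = 0" "t \<in> F"
        have "u t *s w t \<in> H"
          by (rule pencil_zero[OF sH brH[OF h] inH F(2), where w = "\<lambda>t. u t *s w t"])
             (use u w(2) sH in \<open>auto simp: br_right_simps subspace_scale subspace_0\<close>)
        then show "u t = 0"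
          using subspace_scale[OF sH, of "u t *s w t" "inverse (u t)"] w(1)[OF u(2)]
              by (cases "u t = 0") auto
      qed
    qed
    then have inf: "infinite (- ?B)" by (simp add: infinite_UNIV_char_0)
    have nil: "(br (h + t *s a) ^^ dimension) v = 0" if "t \<in> - ?B" for t
    proof -
      let ?c = "h + t *s a"
      have cH: "?c \<in> H" using h aH sH by (simp add: subspace_add subspace_scale)
      have "x \<in> H" if "(br ?c ^^ n) x = 0" for n x
        using that
      proof (induction n arbitrary: x)
        case 0
        then show ?case using sH by (simp add: subspace_0)
      next
        case (Suc n)
        then have "br ?c x \<in> H" by (simp add: funpow_swap1)
        then show ?case using \<open>t \<in> - ?B\<close> by blast
      qed
      then have "gen_eigenspace (br ?c) 0 \<subseteq> H" unfolding gen_eigenspace_def by auto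
      then have "gen_eigenspace (br ?c) 0 = H"
        using a[of ?c] subspace_dim_equal[OF subspace_gen_eigenspace[OF endo_br] sH] unfolding H_def
            by blast
      then have "v \<in> gen_eigenspace (br ?c) 0" using v by simp
      then show ?thesis using funpow_zero_dim[OF endo_br] unfolding gen_eigenspace_def by auto
    qed
    obtain u where u: "u 0 = (br h ^^ dimension) v"
      "\<And>t. (br (h + t *s a) ^^ dimension) v = (\<Sum>i\<le>dimension. t ^ i *s u i)"
      using br_pencil_poly by metis
    then have "u 0 = 0" using inf nil by (intro vector_poly_zero[of "- ?B"]) auto
    then show ?thesis using u(1) by simp
  qed
  then have "H \<subseteq> weight_space H (\<lambda>_. 0)" unfolding weight_space_def gen_eigenspace_def by auto
  \<comment> \<open>As \<open>a \<in> H\<close>, a vector on which all of \<open>H\<close> is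
    nilpotent lies in the null space of ad \<open>a\<close>, which is \<open>H\<close>.\<close>
  moreover have "weight_space H (\<lambda>_. 0) \<subseteq> H" using aH unfolding weight_space_def H_def by blast
  ultimately show ?thesis by blast
qed

end

section \<open>Cartan subalgebras and the Killing form\<close>

locale cartan = fd_lie scale br Basis
  for scale :: "'k::{alg_closed_field, field_char_0} \<Rightarrow> 'a::ab_group_add \<Rightarrow> 'a" (infixr \<open>*s\<close> 75)
    and br :: "'a \<Rightarrow> 'a \<Rightarrow> 'a" and Basis :: "'a set" +
  fixes H :: "'a set"
  assumes H_eq: "H = weight_space H (\<lambda>_. 0)"
begin

abbreviation V :: "('a \<Rightarrow> 'k) \<Rightarrow> 'a set" where
  "V \<equiv> weight_space H"

lemma H_sub: "H \<subseteq> V (\<lambda>_. 0)"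
  using H_eq by simp

lemma subspace_H: "subspace H"
  using subspace_weight_space[of H "\<lambda>_. 0"] H_eq by simp

lemma br_H: "h \<in> H \<Longrightarrow> v \<in> V \<chi> \<Longrightarrow> br h v \<in> V \<chi>"
  using H_sub weight_space_stable by blast

section \<open>Weights and their linearity\<close>

definition weights :: "('a \<Rightarrow> 'k) set" where
  "weights = {\<chi>. vanishes_off H \<chi> \<and> V \<chi> \<noteq> {0}}"

lemma weights_on: "\<chi> \<in> weights \<Longrightarrow> vanishes_off H \<chi>"
  by (simp add: weights_def)

lemma not_weight: "vanishes_off H \<chi> \<Longrightarrow> \<chi> \<notin> weights \<Longrightarrow> V \<chi> = {0}"
  by (simp add: weights_def)

lemma finite_weights: "finite weights"
proof (rule finite_if_card_bounded)
  fix F assume F: "F \<subseteq> weights" "finite F"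
  have "\<exists>v\<in>V \<chi>. v \<noteq> 0" if "\<chi> \<in> F" for \<chi>
    using that F(1) subspace_0[OF subspace_weight_space] unfolding weights_def by blast
  then obtain v where v: "\<And>\<chi>. \<chi> \<in> F \<Longrightarrow> v \<chi> \<in> V \<chi> \<and> v \<chi> \<noteq> 0" by metis
  show "card F \<le> dimension"
  proof (rule family_card_le_dimension[OF F(2), of v])
    fix u \<chi> assume u: "(\<Sum>\<chi>\<in>F. u \<chi> *s v \<chi>) = 0" "\<chi> \<in> F"
    have "u \<chi> *s v \<chi> = 0"
      by (rule weight_space_sum_zero[OF F(2) H_sub _ _ u])
         (use F(1) v weights_on in \<open>auto intro: subspace_scale[OF subspace_weight_space]\<close>)
    then show "u \<chi> = 0" using v u(2) by auto
  qed
qed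

lemma weight_space_inter:
  assumes "vanishes_off H \<chi>" "vanishes_off H \<psi>" "\<chi> \<noteq> \<psi>" "v \<in> V \<chi>" "v \<in> V \<psi>"
  shows "v = 0"
proof -
  have "(if \<chi> = \<chi> then v else - v) = 0"
    by (rule weight_space_sum_zero[where F = "{\<chi>, \<psi>}" and v = "\<lambda>\<xi>. if \<xi> = \<chi> then v else - v", OF _ H_sub])
       (use assms in \<open>auto intro: subspace_neg[OF subspace_weight_space]\<close>)
  then show ?thesis by simp
qed

lemma independent_disjoint:
  assumes "vanishes_off H \<chi>" "vanishes_off H \<psi>" "\<chi> \<noteq> \<psi>" "C \<subseteq> V \<chi>" "D \<subseteq> V \<psi>" "independent C"
  shows "C \<inter> D = {}"
  using weight_space_inter[OF assms(1-3)] assms(4-6) dependent_zero by blast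

lemma independent_Union_weights:
  assumes F: "finite F" and on: "\<And>\<chi>. \<chi> \<in> F \<Longrightarrow> vanishes_off H \<chi>"
    and C: "\<And>\<chi>. \<chi> \<in> F \<Longrightarrow> C \<chi> \<subseteq> V \<chi>" "\<And>\<chi>. \<chi> \<in> F \<Longrightarrow> independent (C \<chi>)"
  shows "independent (\<Union>(C ` F))"
proof (rule independent_if_scalars_zero)
  have fin: "finite (C \<chi>)" if "\<chi> \<in> F" for \<chi> using C(2) that finiteI_independent by blast
  then show "finite (\<Union>(C ` F))" using F by blast
  fix f x assume f: "(\<Sum>x\<in>\<Union>(C ` F). f x *s x) = 0" and x: "x \<in> \<Union>(C ` F)"
  have disj: "C \<chi> \<inter> C \<psi> = {}" if "\<chi> \<in> F" "\<psi> \<in> F" "\<chi> \<noteq> \<psi>" for \<chi> \<psi>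
    using independent_disjoint on C that by metis
  have "(\<Sum>x\<in>\<Union>(C ` F). f x *s x) = (\<Sum>\<chi>\<in>F. \<Sum>x\<in>C \<chi>. f x *s x)"
    by (rule sum.UNION_disjoint) (use F fin disj in auto)
  then have s: "(\<Sum>\<chi>\<in>F. \<Sum>x\<in>C \<chi>. f x *s x) = 0" using f by simp
  obtain \<chi> where \<chi>: "\<chi> \<in> F" "x \<in> C \<chi>" using x by blast
  have "(\<Sum>x\<in>C \<chi>. f x *s x) = 0"
    by (rule weight_space_sum_zero[OF F H_sub on _ s \<chi>(1)])
       (use C(1) in \<open>auto intro!: subspace_sum[OF subspace_weight_space] subspace_scale[OF subspace_weight_space]\<close>)
  then show "f x = 0" using independentD[OF C(2) fin order_refl _ \<chi>(2)] \<chi>(1) by blast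
qed

definition weight_basis :: "('a \<Rightarrow> 'k) \<Rightarrow> 'a set" where
  "weight_basis \<chi> = (SOME C. C \<subseteq> V \<chi> \<and> independent C \<and> span C = V \<chi>)"

lemma weight_basis: "weight_basis \<chi> \<subseteq> V \<chi>" "independent (weight_basis \<chi>)"
    "span (weight_basis \<chi>) = V \<chi>"
proof -
  have "\<exists>C. C \<subseteq> V \<chi> \<and> independent C \<and> span C = V \<chi>"
    by (rule basis_subspace_exists[OF subspace_weight_space]) blast
  then show "weight_basis \<chi> \<subseteq> V \<chi>" "independent (weight_basis \<chi>)" "span (weight_basis \<chi>) = V \<chi>"
    unfolding weight_basis_def by (metis (mono_tags, lifting) someI_ex)+
qed

lemma card_weight_basis_pos: "\<chi> \<in> weights \<Longrightarrow> card (weight_basis \<chi>) > 0"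
proof (rule ccontr)
  assume "\<chi> \<in> weights" "\<not> card (weight_basis \<chi>) > 0"
  moreover have "finite (weight_basis \<chi>)" using weight_basis(2) finiteI_independent by blast
  ultimately have "weight_basis \<chi> = {}" by simp
  then show False using weight_basis(3)[of \<chi>] \<open>\<chi> \<in> weights\<close> by (simp add: weights_def)
qed

lemma span_weight_basis: "span (\<Union>(weight_basis ` weights)) = UNIV"
proof -
  have "V \<chi> \<subseteq> span (\<Union>(weight_basis ` weights))" if "vanishes_off H \<chi>" for \<chi>
  proof (cases "\<chi> \<in> weights")
    case True
    then show ?thesis using weight_basis(3)[of \<chi>] span_mono[of "weight_basis \<chi>"
        "\<Union>(weight_basis ` weights)"] by auto
  qed (use not_weight[OF that] in \<open>auto simp: span_zero\<close>)
  then have "span (\<Union>\<chi>\<in>Collect (vanishes_off H). UNIV \<inter> V \<chi>) \<subseteq> span (\<Union>(weight_basis ` weights))"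
    by (intro span_minimal) auto
  then show ?thesis using weight_space_decomp[OF H_sub, of UNIV] by auto
qed

text \<open>\<open>C\<close> may be any choice of \<open>H\<close>-stable independent subsets of the
  weight spaces, since \<open>card_weight_basis_root\<close> takes a single vector from one of
  them.\<close>

lemma trace_on_weights:
  assumes F: "finite F" and on: "\<And>\<chi>. \<chi> \<in> F \<Longrightarrow> vanishes_off H \<chi>"
    and C: "\<And>\<chi>. \<chi> \<in> F \<Longrightarrow> C \<chi> \<subseteq> V \<chi>" "\<And>\<chi>. \<chi> \<in> F \<Longrightarrow> independent (C \<chi>)"
    and h: "h \<in> H" "\<And>\<chi> b. \<chi> \<in> F \<Longrightarrow> b \<in> C \<chi> \<Longrightarrow> br h b \<in> span (C \<chi>)"
  shows "trace_on (\<Union>(C ` F)) (br h) = (\<Sum>\<chi>\<in>F. \<chi> h * of_nat (card (C \<chi>)))"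
    and "trace_on (\<Union>(C ` F)) (\<lambda>v. br h (br h v)) = (\<Sum>\<chi>\<in>F. (\<chi> h)\<^sup>2 * of_nat (card (C \<chi>)))"
proof -
  have ind: "independent (\<Union>(C ` F))" by (rule independent_Union_weights[OF F on C])
  have disj: "C \<chi> \<inter> C \<psi> = {}" if "\<chi> \<in> F" "\<psi> \<in> F" "\<chi> \<noteq> \<psi>" for \<chi> \<psi>
    using independent_disjoint on C that by metis
  have g: "b \<in> gen_eigenspace (br h) (\<chi> h)" if "\<chi> \<in> F" "b \<in> C \<chi>" for \<chi> b
    using C(1) that h(1) unfolding weight_space_def by blast
  have st: "br h v \<in> span (C \<chi>)" if "\<chi> \<in> F" "v \<in> span (C \<chi>)" for v \<chi>
    by (rule endo_span_image[OF endo_br h(2) subspace_span that(2)]) (use that(1) in auto)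
  have "trace_on (\<Union>(C ` F)) (br h) = (\<Sum>\<chi>\<in>F. trace_on (C \<chi>) (br h))"
    by (rule trace_on_Union[OF F ind disj h(2)])
  also have "\<dots> = (\<Sum>\<chi>\<in>F. \<chi> h * of_nat (card (C \<chi>)))"
    using trace_on_single_eigenvalue(1)[OF endo_br C(2) h(2) g] by (intro sum.cong refl)
  finally show "trace_on (\<Union>(C ` F)) (br h) = (\<Sum>\<chi>\<in>F. \<chi> h * of_nat (card (C \<chi>)))" .
  have "trace_on (\<Union>(C ` F)) (\<lambda>v. br h (br h v)) = (\<Sum>\<chi>\<in>F. trace_on (C \<chi>) (\<lambda>v. br h (br h v)))"
    by (rule trace_on_Union[OF F ind disj]) (use st h(2) in auto)
  also have "\<dots> = (\<Sum>\<chi>\<in>F. (\<chi> h)\<^sup>2 * of_nat (card (C \<chi>)))"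
    using trace_on_single_eigenvalue(2)[OF endo_br C(2) h(2) g] by (intro sum.cong refl)
  finally show "trace_on (\<Union>(C ` F)) (\<lambda>v. br h (br h v)) = (\<Sum>\<chi>\<in>F. (\<chi> h)\<^sup>2 * of_nat (card (C \<chi>)))" .
qed

lemma br_weight_basis: "h \<in> H \<Longrightarrow> b \<in> weight_basis \<chi> \<Longrightarrow> br h b \<in> span (weight_basis \<chi>)"
  using br_H[of h b \<chi>] weight_basis(1,3)[of \<chi>] by auto

lemma trace_on_weight_basis:
  assumes "h \<in> H"
  shows "trace_on (weight_basis \<chi>) (br h) = \<chi> h * of_nat (card (weight_basis \<chi>))"
proof (rule trace_on_single_eigenvalue(1)[OF endo_br weight_basis(2) br_weight_basis[OF assms]])
  show "b \<in> gen_eigenspace (br h) (\<chi> h)" if "b \<in> weight_basis \<chi>" for b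
    using that weight_basis(1)[of \<chi>] assms unfolding weight_space_def by blast
qed

text \<open>The trace of \<open>br h\<close> on \<open>V \<chi>\<close> is \<open>\<chi> h\<close>
  times the dimension and is additive in \<open>h\<close>; the dimension is invertible in
  characteristic 0.\<close>

lemma weight_add:
  assumes "\<chi> \<in> weights" "h \<in> H" "h' \<in> H"
  shows "\<chi> (h + h') = \<chi> h + \<chi> h'"
proof -
  have "\<chi> (h + h') * of_nat (card (weight_basis \<chi>)) = trace_on (weight_basis \<chi>) (\<lambda>v. br h v + br h' v)"
    using trace_on_weight_basis[of "h + h'" \<chi>] subspace_add[OF subspace_H assms(2,3)]
    by (simp add: br_add_left cong: trace_on_cong)
  also have "\<dots> = (\<chi> h + \<chi> h') * of_nat (card (weight_basis \<chi>))"
    by (subst trace_on_add) (simp_all add: weight_basis br_weight_basis[unfolded weight_basis] assms trace_on_weight_basis distrib_right)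
  finally show ?thesis using card_weight_basis_pos[OF assms(1)] by simp
qed

lemma weight_scale:
  assumes "\<chi> \<in> weights" "h \<in> H"
  shows "\<chi> (c *s h) = c * \<chi> h"
proof -
  have "\<chi> (c *s h) * of_nat (card (weight_basis \<chi>)) = trace_on (weight_basis \<chi>) (\<lambda>v. c *s br h v)"
    using trace_on_weight_basis[of "c *s h" \<chi>] subspace_scale[OF subspace_H assms(2)]
    by (simp add: br_scale_left cong: trace_on_cong)
  also have "\<dots> = (c * \<chi> h) * of_nat (card (weight_basis \<chi>))"
    by (subst trace_on_scale) (simp_all add: weight_basis br_weight_basis[unfolded weight_basis] assms trace_on_weight_basis)
  finally show ?thesis using card_weight_basis_pos[OF assms(1)] by simp
qed

lemma br_commutator: "br (br x y) = (\<lambda>v. br x (br y v) - br y (br x v))"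
  by (simp add: fun_eq_iff br_br[of x y])

lemma trace_on_commutator:
  assumes "independent C" "\<And>b. b \<in> C \<Longrightarrow> br x b \<in> span C" "\<And>b. b \<in> C \<Longrightarrow> br y b \<in> span C"
  shows "trace_on C (br (br x y)) = 0"
proof -
  have st: "br z v \<in> span C" if "v \<in> span C" "\<And>b. b \<in> C \<Longrightarrow> br z b \<in> span C" for z v
    using endo_span_image[OF endo_br that(2) subspace_span that(1)] by blast
  have "trace_on C (br (br x y)) = trace_on C (\<lambda>v. br x (br y v)) - trace_on C (\<lambda>v. br y (br x v))"
    unfolding br_commutator using assms st by (intro trace_on_diff) auto
  also have "\<dots> = 0"
    using trace_on_commute[OF endo_br endo_br assms(1,3,2)] by simp
  finally show ?thesis .
qed

text \<open>The trace of \<open>br (br h h')\<close> on \<open>V \<chi>\<close> is that of a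
  commutator, hence 0, and also \<open>\<chi> (br h h')\<close> times the dimension.\<close>

lemma weight_br:
  assumes "\<chi> \<in> weights" "h \<in> H" "h' \<in> H"
  shows "\<chi> (br h h') = 0"
proof -
  have "br h h' \<in> H" using br_H[OF assms(2), of h' "\<lambda>_. 0"] assms(3) H_eq by simp
  then have "\<chi> (br h h') * of_nat (card (weight_basis \<chi>)) = trace_on (weight_basis \<chi>) (br (br h h'))"
    by (simp add: trace_on_weight_basis)
  also have "\<dots> = 0"
    using assms by (intro trace_on_commutator weight_basis br_weight_basis)
  finally show ?thesis using card_weight_basis_pos[OF assms(1)] by simp
qed


section \<open>The Killing form\<close>

definition killing :: "'a \<Rightarrow> 'a \<Rightarrow> 'k" where
  "killing x y = trace_on Basis (\<lambda>z. br x (br y z))"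

lemma trace_on_Basis_simps:
  "trace_on Basis (\<lambda>v. S v + T v) = trace_on Basis S + trace_on Basis T"
  "trace_on Basis (\<lambda>v. S v - T v) = trace_on Basis S - trace_on Basis T"
  "trace_on Basis (\<lambda>v. c *s T v) = c * trace_on Basis T"
  by (simp_all add: trace_on_add trace_on_diff trace_on_scale independent_Basis span_Basis)

lemma killing_simps:
  "killing (x + y) z = killing x z + killing y z" "killing (c *s x) z = c * killing x z"
  "killing x (y + z) = killing x y + killing x z" "killing x (c *s z) = c * killing x z"
  by (simp_all add: killing_def br_left_simps br_right_simps trace_on_Basis_simps)

lemma killing_0: "killing 0 x = 0" "killing x 0 = 0"
  using killing_simps(2)[of 0 0 x] killing_simps(4)[of x 0 0] by simp_all

lemma killing_sym: "killing x y = killing y x"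
  unfolding killing_def
      by (rule trace_on_commute) (simp_all add: endo_br independent_Basis span_Basis)

lemma killing_br: "killing (br x y) z = killing x (br y z)"
proof -
  have "endo (\<lambda>v. br x (br z v))" using endo_br by (auto simp: endo_iff)
  then have "trace_on Basis (\<lambda>v. br y (br x (br z v))) = trace_on Basis (\<lambda>v. br x (br z (br y v)))"
    by (intro trace_on_commute) (simp_all add: endo_br independent_Basis span_Basis)
  then show ?thesis
    by (simp add: killing_def br_commutator br_right_simps trace_on_Basis_simps)
qed

lemma span_induct_V:
  assumes "subspace S" "\<And>\<chi>. \<chi> \<in> weights \<Longrightarrow> V \<chi> \<subseteq> S"
  shows "v \<in> S"
proof -
  have "weight_basis \<chi> \<subseteq> S" if "\<chi> \<in> weights" for \<chi>
    using weight_basis(1) assms(2)[OF that] by (rule order.trans)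
  then have "span (\<Union>(weight_basis ` weights)) \<subseteq> S"
    by (intro span_minimal[OF _ assms(1)] UN_least)
  then show ?thesis using span_weight_basis by auto
qed

lemma independent_weight_basis: "F \<subseteq> weights \<Longrightarrow> independent (\<Union>(weight_basis ` F))"
  using finite_subset[OF _ finite_weights] weights_on weight_basis(1,2)
  by (intro independent_Union_weights) auto

lemma killing_weight_basis: "killing x y = trace_on (\<Union>(weight_basis ` weights)) (\<lambda>z. br x (br y z))"
  unfolding killing_def
proof (rule trace_on_basis_change[OF _ independent_Basis independent_weight_basis[OF order_refl]])
  show "endo (\<lambda>z. br x (br y z))" by (simp add: endo_iff br_right_simps)
qed (simp_all add: span_Basis span_weight_basis)

text \<open>The trace formula covers squares of a single \<open>br h\<close>; mixed values follow by
  polarization and division by 2.\<close>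

lemma killing_H:
  assumes "h \<in> H" "h' \<in> H"
  shows "killing h h' = (\<Sum>\<chi>\<in>weights. \<chi> h * \<chi> h' * of_nat (card (weight_basis \<chi>)))"
proof -
  have sq: "killing h h = (\<Sum>\<chi>\<in>weights. (\<chi> h)\<^sup>2 * of_nat (card (weight_basis \<chi>)))" if "h \<in> H" for h
    unfolding killing_weight_basis
    by (rule trace_on_weights(2)[OF finite_weights weights_on]) (use that weight_basis(1,2) br_weight_basis in auto)
  have "killing (h + h') (h + h') = killing h h + 2 * killing h h' + killing h' h'"
    by (simp add: killing_simps killing_sym[of h' h])
  moreover have "killing (h + h') (h + h')
      = killing h h + 2 * (\<Sum>\<chi>\<in>weights. \<chi> h * \<chi> h' * of_nat (card (weight_basis \<chi>))) + killing h' h'"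
    using assms subspace_add[OF subspace_H]
    by (simp add: sq weight_add power2_sum sum.distrib[symmetric] sum_distrib_left algebra_simps)
  ultimately show ?thesis by simp
qed

text \<open>The composite of \<open>br x\<close> and \<open>br y\<close> shifts weights by \<alpha>
  + \<beta>, which is nonzero, so the image of a basis vector has no component along that
  vector.\<close>

lemma killing_orthogonal:
  assumes "vanishes_off H \<alpha>" "vanishes_off H \<beta>" "(\<lambda>h. \<alpha> h + \<beta> h) \<noteq> (\<lambda>_. 0)" "x \<in> V \<alpha>" "y \<in> V \<beta>"
  shows "killing x y = 0"
proof -
  let ?B = "\<Union>(weight_basis ` weights)"
  have "representation ?B (br x (br y b)) b = 0" if b: "b \<in> ?B" for b
  proof -
    obtain \<chi> where \<chi>: "\<chi> \<in> weights" "b \<in> weight_basis \<chi>" using b by blast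
    define \<psi> where "\<psi> = (\<lambda>h. \<alpha> h + (\<beta> h + \<chi> h))"
    have w: "br x (br y b) \<in> V \<psi>"
      unfolding \<psi>_def using assms(4,5) \<chi>(2) weight_basis(1) by (intro weight_space_br) auto
    have on: "vanishes_off H \<psi>" using assms(1,2) weights_on[OF \<chi>(1)]
        by (simp add: vanishes_off_def \<psi>_def)
    have ne: "\<chi> \<noteq> \<psi>"
      using assms(3) by (auto simp: \<psi>_def fun_eq_iff)
    show ?thesis
    proof (cases "\<psi> \<in> weights")
      case True
      have "representation ?B (br x (br y b)) = representation (weight_basis \<psi>) (br x (br y b))"
        by (rule representation_extend[OF independent_weight_basis]) (use True weight_basis(3) w in auto)
      moreover have "b \<notin> weight_basis \<psi>"
        using independent_disjoint[OF weights_on[OF \<chi>(1)] on ne weight_basis(1) weight_basis(1) weight_basis(2)] \<chi>(2) by blast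
      ultimately show ?thesis using representation_ne_zero by metis
    next
      case False
      then show ?thesis using w not_weight[OF on] by (simp add: representation_zero)
    qed
  qed
  then show ?thesis by (simp add: killing_weight_basis trace_on_def)
qed

text \<open>The trace of \<open>[x, y]\<close> on the \<open>\<alpha>\<close>-string through \<open>\<beta>\<close> vanishes.\<close>

lemma weight_string:
  assumes \<alpha>: "vanishes_off H \<alpha>"
      "\<alpha> \<noteq> (\<lambda>_. 0)" and x: "x \<in> V \<alpha>" and y: "y \<in> V (\<lambda>h. - \<alpha> h)" and \<beta>: "\<beta> \<in> weights"
  shows "\<exists>r. \<beta> (br x y) = of_rat r * \<alpha> (br x y)"
proof -
  let ?h = "br x y" and ?s = "\<lambda>j h. \<beta> h + of_int j * \<alpha> h"
  have hH: "?h \<in> H" using weight_space_br[OF x y] H_eq by simp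
  define X where "X = {\<chi> \<in> weights. \<exists>j. \<chi> = ?s j}"
  have X: "finite X" "X \<subseteq> weights" using finite_weights by (auto simp: X_def)
  have "\<forall>\<chi>\<in>X. \<exists>j. \<chi> = ?s j" unfolding X_def by blast
  from bchoice[OF this] obtain j where j: "\<And>\<chi>. \<chi> \<in> X \<Longrightarrow> \<chi> = ?s (j \<chi>)" by blast
  have "?s 0 = \<beta>" by simp
  then have \<beta>X: "\<beta> \<in> X" unfolding X_def using \<beta> by (auto intro!: exI[of _ 0])
  let ?M = "\<Union>(weight_basis ` X)"
  \<comment> \<open>A general multiple \<open>i\<close> treats \<open>x\<close>
    (\<open>i = 1\<close>) and \<open>y\<close> (\<open>i = -1\<close>) at once. Where the string
    leaves the set of weights, the target space is zero.\<close>
  have st: "br z b \<in> span ?M" if z: "z \<in> V (\<lambda>h. of_int i * \<alpha> h)" and b: "b \<in> ?M" for z b i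
  proof -
    obtain \<chi> where \<chi>: "\<chi> \<in> X" "b \<in> weight_basis \<chi>" using b by blast
    have e: "(\<lambda>h. of_int i * \<alpha> h + \<chi> h) = ?s (i + j \<chi>)"
      by (subst j[OF \<chi>(1)]) (simp add: fun_eq_iff algebra_simps)
    have w: "br z b \<in> V (?s (i + j \<chi>))"
      using weight_space_br[OF z, of b \<chi>] \<chi>(2) weight_basis(1) e by auto
    show ?thesis
    proof (cases "?s (i + j \<chi>) \<in> weights")
      case True
      then have "weight_basis (?s (i + j \<chi>)) \<subseteq> ?M" unfolding X_def by blast
      then show ?thesis using w weight_basis(3) span_mono by blast
    next
      case False
      have "vanishes_off H (?s (i + j \<chi>))" using \<alpha>(1) weights_on[OF \<beta>]
          by (simp add: vanishes_off_def)
      then show ?thesis using not_weight False w by (auto simp: span_zero)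
    qed
  qed
  \<comment> \<open>\<open>N\<close> is the dimension of the string and \<open>Z\<close> the sum of
    its positions weighted by dimension. The vanishing trace reads
    \<open>\<beta> ?h * N + \<alpha> ?h * Z = 0\<close>, whence the rational factor
    \<open>- Z / N\<close>.\<close>
  define N where "N = (\<Sum>\<chi>\<in>X. card (weight_basis \<chi>))"
  define Z where "Z = (\<Sum>\<chi>\<in>X. j \<chi> * int (card (weight_basis \<chi>)))"
  have "0 = trace_on ?M (br ?h)"
    using st[of x 1] st[of y "-1"] x y X(2)
    by (intro trace_on_commutator[symmetric] independent_weight_basis) auto
  also have "\<dots> = (\<Sum>\<chi>\<in>X. \<chi> ?h * of_nat (card (weight_basis \<chi>)))"
    by (rule trace_on_weights(1)[OF X(1)]) (use X(2) weights_on weight_basis(1,2) br_weight_basis hH in auto)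
  also have "\<dots> = (\<Sum>\<chi>\<in>X. \<beta> ?h * of_nat (card (weight_basis \<chi>)) + \<alpha> ?h * of_int (j \<chi> * int (card (weight_basis \<chi>))))"
  proof (rule sum.cong[OF refl])
    fix \<chi> assume "\<chi> \<in> X"
    then have "\<chi> ?h = \<beta> ?h + of_int (j \<chi>) * \<alpha> ?h" using j by metis
    then show "\<chi> ?h * of_nat (card (weight_basis \<chi>)) = \<beta> ?h * of_nat (card (weight_basis \<chi>)) + \<alpha> ?h * of_int (j \<chi> * int (card (weight_basis \<chi>)))"
      by (simp add: algebra_simps)
  qed
  also have "\<dots> = \<beta> ?h * of_nat N + \<alpha> ?h * of_int Z"
    by (simp add: N_def Z_def sum.distrib sum_distrib_left)
  finally have NZ: "\<beta> ?h * of_nat N + \<alpha> ?h * of_int Z = 0" by simp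
  have "N > 0"
    using card_weight_basis_pos[OF \<beta>] member_le_sum[OF \<beta>X, of "\<lambda>\<chi>. card (weight_basis \<chi>)"] X(1)
        by (simp add: N_def)
  moreover have "\<beta> ?h * of_nat N = - (of_int Z * \<alpha> ?h)"
    using NZ by (metis eq_neg_iff_add_eq_0 mult.commute)
  ultimately have "\<beta> ?h = - (of_int Z * \<alpha> ?h) / of_nat N"
    by (intro nonzero_eq_divide_eq[THEN iffD2]) simp_all
  then have "\<beta> ?h = of_rat (- of_int Z / of_nat N) * \<alpha> ?h"
    unfolding of_rat_divide of_rat_minus of_rat_of_int_eq of_rat_of_nat_eq by simp
  then show ?thesis by blast
qed

end

section \<open>Semisimple Lie algebras are generated by two elements\<close>

context fd_lie
begin

text \<open>Level \<open>n\<close> consists of the vectors killed by all products of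
  \<open>n\<close> maps \<open>br x\<close> with \<open>x \<in> K\<close>. Reaching
  \<open>UNIV\<close> means that these maps generate a nilpotent associative algebra.\<close>

fun ascending :: "'a set \<Rightarrow> nat \<Rightarrow> 'a set" where
  "ascending K 0 = {0}"
| "ascending K (Suc n) = {v. \<forall>x\<in>K. br x v \<in> ascending K n}"

lemma subspace_ascending: "subspace (ascending K n)"
  by (induction n) (auto intro!: subspaceI simp: subspace_0 subspace_add subspace_scale br_right_simps)

lemma ascending_Suc_mono: "ascending K n \<subseteq> ascending K (Suc n)"
  by (induction n) (auto simp: br_right_simps)

lemma ascending_mono: "n \<le> m \<Longrightarrow> ascending K n \<subseteq> ascending K m"
  by (rule lift_Suc_mono_le[of "ascending K"]) (rule ascending_Suc_mono)

lemma ascending_antimono: "K \<subseteq> L \<Longrightarrow> ascending L n \<subseteq> ascending K n"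
  by (induction n) auto

lemma ascending_span: "ascending (span K) n = ascending K n"
proof (induction n)
  case (Suc n)
  have "br x v \<in> ascending K n" if "\<And>x. x \<in> K \<Longrightarrow> br x v \<in> ascending K n" "x \<in> span K" for x v
    using endo_span_image[OF endo_br_left that(1) subspace_ascending that(2)] by blast
  then show ?case using Suc span_base by auto
qed simp

text \<open>Since \<open>w\<close> normalizes \<open>span K\<close>, ad \<open>w\<close> preserves
  every level of \<open>K\<close>. Elements of \<open>K\<close> lower the level of a vector, and at
  most \<open>r\<close> applications of ad \<open>w\<close> kill it, so \<open>r\<close> further
  levels suffice for \<open>insert w K\<close>.\<close>

lemma ascending_insert:
  assumes w: "\<And>x. x \<in> K \<Longrightarrow> br x w \<in> span K" "\<And>v. (br w ^^ r) v = 0"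
  shows "\<exists>m. ascending K n \<subseteq> ascending (insert w K) m"
proof (induction n)
  case 0
  show ?case by (intro exI[of _ 0]) simp
next
  case (Suc n)
  then obtain m where m: "ascending K n \<subseteq> ascending (insert w K) m" by blast
  have st: "v \<in> ascending K j \<Longrightarrow> br w v \<in> ascending K j" for j v
  proof (induction j arbitrary: v)
    case (Suc j)
    have "br x (br w v) \<in> ascending K j" if x: "x \<in> K" for x
    proof -
      have "v \<in> ascending (span K) (Suc j)" using Suc.prems ascending_span by blast
      then have "br (br x w) v \<in> ascending K j" using w(1)[OF x] ascending_span[of K j] by simp
      moreover have "br w (br x v) \<in> ascending K j" using Suc x by simp
      ultimately show ?thesis using br_br[of x w v] subspace_add[OF subspace_ascending] by simp
    qed
    then show ?case by simp
  qed (simp add: br_right_simps)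
  have "u \<in> ascending K (Suc n) \<Longrightarrow> (br w ^^ i) u = 0 \<Longrightarrow> u \<in> ascending (insert w K) (m + i)" for i u
  proof (induction i arbitrary: u)
    case 0
    then show ?case using subspace_0[OF subspace_ascending] by simp
  next
    case (Suc i)
    have "br w u \<in> ascending (insert w K) (m + i)"
      using Suc.IH[of "br w u"] st[OF Suc.prems(1)] Suc.prems(2) by (simp add: funpow_swap1)
    moreover have "br x u \<in> ascending (insert w K) (m + i)" if "x \<in> K" for x
      using Suc.prems(1) that m ascending_mono[of m "m + i" "insert w K"] by auto
    ultimately show ?case by auto
  qed
  then have "ascending K (Suc n) \<subseteq> ascending (insert w K) (m + r)" using w(2) by blast
  then show ?case by blast
qed

text \<open>Jacobson's version of Engel's theorem: \<open>\<Omega>\<close> need not be a subspace.\<close>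

lemma engel:
  assumes \<Omega>: "\<And>x y. x \<in> \<Omega> \<Longrightarrow> y \<in> \<Omega> \<Longrightarrow> br x y \<in> \<Omega>" "\<And>x. x \<in> \<Omega> \<Longrightarrow> gen_eigenspace (br x) 0 = UNIV"
  shows "\<exists>n. ascending \<Omega> n = UNIV"
proof -
  let ?P = "\<lambda>K. K \<subseteq> \<Omega> \<and> (\<exists>n. ascending K n = UNIV)"
  have "ascending {} (Suc 0) = UNIV" by simp
  then have "?P {}" by blast
  moreover have "\<forall>K. ?P K \<longrightarrow> dim K < Suc dimension" using dim_subset_UNIV
      by (simp add: le_imp_less_Suc)
  ultimately obtain K where K: "?P K" "\<And>L. ?P L \<Longrightarrow> dim L \<le> dim K"
    using ex_has_greatest_nat[of ?P "{}" dim "Suc dimension"] by blast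
  obtain n where n: "ascending K n = UNIV" using K(1) by blast
  have "\<Omega> \<subseteq> span K"
  proof (rule ccontr)
    \<comment> \<open>Take \<open>w\<close> in the first level of \<open>K\<close> that meets
      \<Omega> outside \<open>span K\<close>. Its brackets with \<open>K\<close> stay in \<Omega>
      and drop one level, so they fall into \<open>span K\<close>. Hence \<open>w\<close> normalizes
      \<open>span K\<close> and can be added, against maximality of \<open>dim K\<close>.\<close>
    let ?Q = "\<lambda>j. \<exists>w\<in>\<Omega> - span K. w \<in> ascending K j"
    assume "\<not> \<Omega> \<subseteq> span K"
    then have "?Q n" using n by blast
    define j where "j = (LEAST j. ?Q j)"
    have j: "?Q j" "\<And>i. i < j \<Longrightarrow> \<not> ?Q i"
      unfolding j_def using LeastI[of ?Q, OF \<open>?Q n\<close>] not_less_Least[of _ ?Q] by blast+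
    then obtain w where w: "w \<in> \<Omega>" "w \<notin> span K" "w \<in> ascending K j" by blast
    have "j \<noteq> 0" using w span_zero by (metis ascending.simps(1) singletonD)
    then obtain i where i: "j = Suc i" using not0_implies_Suc by blast
    have "br x w \<in> span K" if x: "x \<in> K" for x
    proof -
      have "br x w \<in> \<Omega>" using x K(1) w(1) by (intro \<Omega>(1)) auto
      moreover have "br x w \<in> ascending K i" using w(3) i x by simp
      ultimately show ?thesis using j(2)[of i] i by blast
    qed
    moreover have "(br w ^^ dimension) v = 0" for v
    proof -
      have "v \<in> gen_eigenspace (br w) 0" using \<Omega>(2)[OF w(1)] by simp
      then show ?thesis using funpow_zero_dim[OF endo_br] unfolding gen_eigenspace_def by auto
    qed
    ultimately obtain m where "ascending K n \<subseteq> ascending (insert w K) m" using ascending_insert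
        by blast
    then have "?P (insert w K)" using n w(1) K(1) by blast
    then have "dim (insert w K) \<le> dim K" by (rule K(2))
    then show False using w(2) by (simp add: dim_insert)
  qed
  then have "ascending (span K) n \<subseteq> ascending \<Omega> n" by (rule ascending_antimono)
  then show ?thesis using n by (auto simp: ascending_span)
qed

text \<open>A nonzero element of \<open>W\<close> in the lowest possible level works: its brackets
  with \<Omega> lie in \<open>W\<close> one level below, so they vanish.\<close>

lemma engel_annihilated:
  assumes \<Omega>: "\<And>x y. x \<in> \<Omega> \<Longrightarrow> y \<in> \<Omega> \<Longrightarrow> br x y \<in> \<Omega>" "\<And>x. x \<in> \<Omega> \<Longrightarrow> gen_eigenspace (br x) 0 = UNIV"
    and W: "W \<noteq> {0}" "0 \<in> W" "\<And>x w. x \<in> \<Omega> \<Longrightarrow> w \<in> W \<Longrightarrow> br x w \<in> W"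
  shows "\<exists>z\<in>W. z \<noteq> 0 \<and> (\<forall>x\<in>\<Omega>. br x z = 0)"
proof -
  obtain n where "ascending \<Omega> n = UNIV" using engel[OF \<Omega>] by blast
  let ?Q = "\<lambda>j. \<exists>w\<in>W. w \<noteq> 0 \<and> w \<in> ascending \<Omega> j"
  have "?Q n" using W(1,2) \<open>ascending \<Omega> n = UNIV\<close> by auto
  define j where "j = (LEAST j. ?Q j)"
  have j: "?Q j" "\<And>i. i < j \<Longrightarrow> \<not> ?Q i"
    unfolding j_def using LeastI[of ?Q, OF \<open>?Q n\<close>] not_less_Least[of _ ?Q] by blast+
  then obtain w where w: "w \<in> W" "w \<noteq> 0" "w \<in> ascending \<Omega> j" by blast
  then obtain i where i: "j = Suc i" by (cases j) auto
  have "br x w = 0" if "x \<in> \<Omega>" for x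
    using j(2)[of i] w i that W(3) by auto
  then show ?thesis using w by blast
qed

section \<open>Abelian ideals and commutator ideals\<close>

lemma abelian_solvable: "0 \<in> I \<Longrightarrow> (\<And>x y. x \<in> I \<Longrightarrow> y \<in> I \<Longrightarrow> br x y = 0) \<Longrightarrow> solvable I"
proof -
  assume I: "0 \<in> I" "\<And>x y. x \<in> I \<Longrightarrow> y \<in> I \<Longrightarrow> br x y = 0"
  then have "{br x y | x y. x \<in> I \<and> y \<in> I} = {0}" by force
  then have "derived_series I (Suc 0) = {0}" by simp
  then show ?thesis unfolding solvable_def by blast
qed

lemma idealI: "subspace I \<Longrightarrow> (\<And>x y. y \<in> I \<Longrightarrow> br x y \<in> I) \<Longrightarrow> ideal I"
  unfolding ideal_def by (metis br_antisym subspace_neg)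

lemma idealD: "ideal I \<Longrightarrow> subspace I" "ideal I \<Longrightarrow> y \<in> I \<Longrightarrow> br x y \<in> I" "ideal I \<Longrightarrow> y \<in> I \<Longrightarrow> br y x \<in> I"
  unfolding ideal_def by blast+

lemma ideal_commutators:
  assumes "ideal I"
  shows "ideal (span {br x y | x y. x \<in> I \<and> y \<in> I})"
proof (rule idealI)
  let ?D = "{br x y | x y. x \<in> I \<and> y \<in> I}"
  fix z v assume v: "v \<in> span ?D"
  show "br z v \<in> span ?D"
  proof (rule endo_span_image[OF endo_br _ subspace_span v])
    fix b assume "b \<in> ?D"
    then obtain x y where b: "b = br x y" "x \<in> I" "y \<in> I" by blast
    then have "br (br z x) y \<in> ?D" "br x (br z y) \<in> ?D" using idealD[OF assms] by blast+
    then have "br (br z x) y + br x (br z y) \<in> span ?D" by (intro span_add span_base)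
    then show "br z b \<in> span ?D" using b(1) br_br[of z x y] by simp
  qed
qed simp

end


locale semisimple_cartan = cartan scale br Basis H
  for scale :: "'k::{alg_closed_field, field_char_0} \<Rightarrow> 'a::ab_group_add \<Rightarrow> 'a" (infixr \<open>*s\<close> 75)
    and br :: "'a \<Rightarrow> 'a \<Rightarrow> 'a" and Basis :: "'a set" and H :: "'a set" +
  assumes solvable_ideal_trivial: "ideal I \<Longrightarrow> solvable I \<Longrightarrow> I = {0}"
begin

lemma abelian_ideal_trivial: "ideal I \<Longrightarrow> (\<And>x y. x \<in> I \<Longrightarrow> y \<in> I \<Longrightarrow> br x y = 0) \<Longrightarrow> I = {0}"
  using solvable_ideal_trivial abelian_solvable idealD(1) subspace_0 by metis

section \<open>Nondegeneracy of the Killing form\<close>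

definition killing_rad :: "'a set" where
  "killing_rad = {x. \<forall>y. killing x y = 0}"

lemma ideal_killing_rad: "ideal killing_rad"
proof (rule idealI)
  show "subspace killing_rad"
      by (rule subspaceI) (simp_all add: killing_rad_def killing_simps killing_0)
  show "br x y \<in> killing_rad" if "y \<in> killing_rad" for x y
    using that br_antisym[of x y] killing_br[of y x]
        by (simp add: killing_rad_def br_left_simps) (metis killing_br killing_sym)
qed

lemma null_bracket:
  assumes \<alpha>: "vanishes_off H \<alpha>" "\<alpha> \<noteq> (\<lambda>_. 0)" and x: "x \<in> V \<alpha>" and y: "y \<in> V (\<lambda>h. - \<alpha> h)"
    and 0: "killing (br x y) (br x y) = 0" and \<beta>: "\<beta> \<in> weights"
  shows "\<beta> (br x y) = 0"
proof -
  let ?h = "br x y"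
  have hH: "?h \<in> H" using weight_space_br[OF x y] H_eq by simp
  have "\<forall>\<beta>\<in>weights. \<exists>r. \<beta> ?h = of_rat r * \<alpha> ?h" using weight_string[OF \<alpha> x y] by blast
  from bchoice[OF this] obtain r where r: "\<And>\<beta>. \<beta> \<in> weights \<Longrightarrow> \<beta> ?h = of_rat (r \<beta>) * \<alpha> ?h" by blast
  have "0 = (\<Sum>\<chi>\<in>weights. \<chi> ?h * \<chi> ?h * of_nat (card (weight_basis \<chi>)))"
    using killing_H[OF hH hH] 0 by simp
  also have "\<dots> = (\<Sum>\<chi>\<in>weights. of_rat ((r \<chi>)\<^sup>2 * of_nat (card (weight_basis \<chi>))) * (\<alpha> ?h)\<^sup>2)"
    by (intro sum.cong refl) (simp add: r of_rat_mult of_rat_power power2_eq_square mult_ac)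
  also have "\<dots> = of_rat (\<Sum>\<chi>\<in>weights. (r \<chi>)\<^sup>2 * of_nat (card (weight_basis \<chi>))) * (\<alpha> ?h)\<^sup>2"
    by (simp add: of_rat_sum sum_distrib_right)
  finally have "of_rat (\<Sum>\<chi>\<in>weights. (r \<chi>)\<^sup>2 * of_nat (card (weight_basis \<chi>))) = (0::'k) \<or> \<alpha> ?h = 0"
      by simp
  then show ?thesis
  proof
    assume "of_rat (\<Sum>\<chi>\<in>weights. (r \<chi>)\<^sup>2 * of_nat (card (weight_basis \<chi>))) = (0::'k)"
    then have "(r \<beta>)\<^sup>2 * of_nat (card (weight_basis \<beta>)) = 0"
      using sum_nonneg_eq_0_iff[OF finite_weights, of "\<lambda>\<chi>. (r \<chi>)\<^sup>2 * of_nat (card (weight_basis \<chi>))"] \<beta> by simp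
    then show ?thesis using r[OF \<beta>] card_weight_basis_pos[OF \<beta>] by simp
  qed (simp add: r[OF \<beta>])
qed

definition graded_rad :: "'a set" where
  "graded_rad = {x \<in> killing_rad. \<exists>\<alpha>. vanishes_off H \<alpha> \<and> x \<in> V \<alpha> \<and> (\<alpha>
      = (\<lambda>_. 0) \<longrightarrow> (\<forall>\<beta>\<in>weights. \<beta> x = 0))}"

text \<open>Any homogeneous elements of the radical are allowed as arguments, so this gives both
  closure of \<open>graded_rad\<close> under brackets and a spanning set of the commutator ideal. If
  the weights cancel, either both elements lie in \<open>H\<close> and \<open>weight_br\<close>
  applies, or \<open>null_bracket\<close> does.\<close>

lemma br_graded_rad:
  assumes "x \<in> killing_rad" "y \<in> killing_rad" "vanishes_off H \<alpha>" "vanishes_off H \<beta>" "x \<in> V \<alpha>"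
      "y \<in> V \<beta>"
  shows "br x y \<in> graded_rad"
proof -
  let ?\<gamma> = "\<lambda>h. \<alpha> h + \<beta> h"
  have r: "br x y \<in> killing_rad" using idealD(2)[OF ideal_killing_rad assms(2)] .
  have "\<chi> (br x y) = 0" if z: "?\<gamma> = (\<lambda>_. 0)" and \<chi>: "\<chi> \<in> weights" for \<chi>
  proof (cases "\<alpha> = (\<lambda>_. 0)")
    case True
    then have "\<beta> = (\<lambda>_. 0)" using z by simp
    then show ?thesis using True assms H_eq weight_br[OF \<chi>] by simp
  next
    case False
    have "\<beta> = (\<lambda>h. - \<alpha> h)" using z by (simp add: fun_eq_iff eq_neg_iff_add_eq_0 add.commute)
    then show ?thesis
      using null_bracket[OF assms(3) False assms(5) _ _ \<chi>] assms(6) r by (simp add: killing_rad_def)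
  qed
  moreover have "vanishes_off H ?\<gamma>" using assms(3,4) by (simp add: vanishes_off_def)
  ultimately show ?thesis
    using r weight_space_br[OF assms(5,6)] unfolding graded_rad_def by (auto intro!: exI[of _ ?\<gamma>])
qed

text \<open>For weight 0, \<open>br x\<close> has the single generalized eigenvalue
  \<open>\<chi> x = 0\<close> on \<open>V \<chi>\<close>. For nonzero \<alpha>, its powers move
  \<open>V \<chi>\<close> along the infinitely many functions \<chi> + n \<alpha>, not all of which
  can be weights.\<close>

lemma graded_rad_nilpotent:
  assumes "x \<in> graded_rad"
  shows "gen_eigenspace (br x) 0 = UNIV"
proof -
  obtain \<alpha> where \<alpha>: "vanishes_off H \<alpha>" "x \<in> V \<alpha>" "\<alpha> = (\<lambda>_. 0) \<Longrightarrow> \<forall>\<beta>\<in>weights. \<beta> x = 0"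
    using assms unfolding graded_rad_def by blast
  have "V \<chi> \<subseteq> gen_eigenspace (br x) 0" if \<chi>: "\<chi> \<in> weights" for \<chi>
  proof (cases "\<alpha> = (\<lambda>_. 0)")
    case True
    then have "x \<in> H" "\<chi> x = 0" using \<alpha> H_eq \<chi> by auto
    then show ?thesis unfolding weight_space_def by force
  next
    case False
    then obtain h where h: "\<alpha> h \<noteq> 0" by auto
    let ?s = "\<lambda>n h. \<chi> h + of_nat n * \<alpha> h"
    have "inj ?s"
    proof (rule injI)
      fix n m assume "?s n = ?s m"
      then have "?s n h = ?s m h" by (rule fun_cong)
      then show "n = m" using h by simp
    qed
    then have "infinite (range ?s)" using finite_imageD infinite_UNIV_nat by blast
    then have "\<not> range ?s \<subseteq> weights" using finite_weights finite_subset by blast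
    then obtain n where n: "?s n \<notin> weights" by blast
    have it: "(br x ^^ m) v \<in> V (?s m)" if "v \<in> V \<chi>" for v m
    proof (induction m)
      case (Suc m)
      have "(\<lambda>h. \<alpha> h + ?s m h) = ?s (Suc m)" by (simp add: fun_eq_iff algebra_simps)
      then show ?case using weight_space_br[OF \<alpha>(2) Suc] by simp
    qed (use that in simp)
    have "vanishes_off H (?s n)" using weights_on[OF \<chi>] \<alpha>(1) by (simp add: vanishes_off_def)
    then have "V (?s n) = {0}" using n by (rule not_weight)
    then have "(br x ^^ n) v = 0" if "v \<in> V \<chi>" for v using it[OF that, of n] by blast
    then show ?thesis unfolding gen_eigenspace_def by auto
  qed
  then show ?thesis using span_induct_V[OF subspace_gen_eigenspace[OF endo_br]] by blast
qed

text \<open>If the commutator ideal of the radical were nonzero, Engel's theorem would give a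
  nonzero vector in it killed by \<open>graded_rad\<close>, hence by the whole commutator ideal. Its
  centre would then be a nonzero abelian ideal. So the commutator ideal is zero and the radical is
  itself an abelian ideal.\<close>

lemma killing_rad_zero: "killing_rad = {0}"
proof -
  let ?D = "span {br x y | x y. x \<in> killing_rad \<and> y \<in> killing_rad}"
  have iD: "ideal ?D" by (rule ideal_commutators[OF ideal_killing_rad])
  let ?X = "\<Union>\<chi>\<in>Collect (vanishes_off H). killing_rad \<inter> V \<chi>"
  have X: "killing_rad \<subseteq> span ?X"
    using idealD[OF ideal_killing_rad] by (intro weight_space_decomp[OF H_sub]) auto
  have "br x y \<in> span graded_rad" if "x \<in> killing_rad" "y \<in> killing_rad" for x y
  proof (rule br_span_mem[of ?X ?X])
    show "br x y \<in> span graded_rad" if "x \<in> ?X" "y \<in> ?X" for x y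
      using that br_graded_rad by (auto intro: span_base)
  qed (use X that in blast)+
  then have "{br x y | x y. x \<in> killing_rad \<and> y \<in> killing_rad} \<subseteq> span graded_rad" by blast
  then have D: "?D \<subseteq> span graded_rad" by (rule span_minimal) simp
  have "?D = {0}"
  proof (rule ccontr)
    assume ne: "?D \<noteq> {0}"
    have "\<exists>z\<in>?D. z \<noteq> 0 \<and> (\<forall>x\<in>graded_rad. br x z = 0)"
    proof (rule engel_annihilated[OF _ graded_rad_nilpotent ne span_zero])
      show "br x y \<in> graded_rad" if "x \<in> graded_rad" "y \<in> graded_rad" for x y
        using that br_graded_rad unfolding graded_rad_def by blast
      show "br x w \<in> ?D" if "w \<in> ?D" for x w using idealD(2)[OF iD that] .
    qed
    then obtain z where z: "z \<in> ?D" "z \<noteq> 0" "\<And>x. x \<in> graded_rad \<Longrightarrow> br x z = 0" by blast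
    let ?Z = "{z \<in> ?D. \<forall>x\<in>?D. br x z = 0}"
    have "br x z = 0" if "x \<in> ?D" for x
      using endo_span_image[OF endo_br_left, of graded_rad z "{0}" x] z(3) D that by auto
    then have "z \<in> ?Z" using z(1) by blast
    moreover have "?Z = {0}"
    proof (rule abelian_ideal_trivial)
      show "ideal ?Z"
      proof (rule idealI)
        show "subspace ?Z"
          by (rule subspaceI) (auto simp: span_zero span_add span_scale br_right_simps)
        fix x y assume y: "y \<in> ?Z"
        have "br v (br x y) = 0" if v: "v \<in> ?D" for v
          using br_br[of v x y] y v idealD(3)[OF iD v, of x] by (simp add: br_right_simps)
        then show "br x y \<in> ?Z" using y idealD(2)[OF iD] by blast
      qed
    qed auto
    ultimately show False using z(2) by blast
  qed
  then have "br x y = 0" if "x \<in> killing_rad" "y \<in> killing_rad" for x y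
    using that span_base[of "br x y" "{br x y | x y. x \<in> killing_rad \<and> y \<in> killing_rad}"] by blast
  then show ?thesis using abelian_ideal_trivial[OF ideal_killing_rad] by blast
qed

lemma killing_nondegenerate: "(\<And>y. killing x y = 0) \<Longrightarrow> x = 0"
  using killing_rad_zero unfolding killing_rad_def by blast

section \<open>Root spaces\<close>

lemma killing_zero_if_weights:
  assumes "\<And>\<chi> y. \<chi> \<in> weights \<Longrightarrow> y \<in> V \<chi> \<Longrightarrow> killing x y = 0"
  shows "x = 0"
proof -
  have "y \<in> {y. killing x y = 0}" for y
    by (rule span_induct_V) (use assms in \<open>auto intro!: subspaceI simp: killing_simps killing_0\<close>)
  then show ?thesis using killing_nondegenerate by blast
qed

lemma on_0: "vanishes_off H (\<lambda>_. 0)" and on_uminus: "vanishes_off H \<alpha> \<Longrightarrow> vanishes_off H (\<lambda>h. - \<alpha> h)"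
  by (simp_all add: vanishes_off_def)

text \<open>Nondegeneracy gives some vector pairing nontrivially with \<open>x\<close>, and by
  \<open>killing_orthogonal\<close> only a component of weight -\<alpha> can contribute.\<close>

lemma pairing:
  assumes "vanishes_off H \<alpha>" "x \<in> V \<alpha>" "x \<noteq> 0"
  shows "\<exists>y\<in>V (\<lambda>h. - \<alpha> h). killing x y \<noteq> 0"
proof (rule ccontr)
  assume c: "\<not> ?thesis"
  have "x = 0"
  proof (rule killing_zero_if_weights)
    fix \<chi> y assume \<chi>: "\<chi> \<in> weights" "y \<in> V \<chi>"
    show "killing x y = 0"
    proof (cases "(\<lambda>h. \<alpha> h + \<chi> h) = (\<lambda>_. 0)")
      case True
      then have "\<chi> = (\<lambda>h. - \<alpha> h)" by (simp add: fun_eq_iff eq_neg_iff_add_eq_0 add.commute)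
      then show ?thesis using c \<chi> by blast
    next
      case False
      show ?thesis by (rule killing_orthogonal[OF assms(1) weights_on[OF \<chi>(1)] False assms(2) \<chi>(2)])
    qed
  qed
  then show False using assms(3) by blast
qed

text \<open>\<open>pairing\<close> for weight 0 makes the Killing form nondegenerate on
  \<open>H\<close>, where \<open>killing_H\<close> expresses it through the values of the
  weights.\<close>

lemma H_zero:
  assumes "h \<in> H" "\<And>\<chi>. \<chi> \<in> weights \<Longrightarrow> \<chi> h = 0"
  shows "h = 0"
proof (rule ccontr)
  assume "h \<noteq> 0"
  then obtain y where "y \<in> H" "killing h y \<noteq> 0"
    using pairing[OF on_0, of h] assms(1) H_eq by auto
  moreover have "killing h y = 0"
    unfolding killing_H[OF assms(1) \<open>y \<in> H\<close>] using assms(2) by (intro sum.neutral) simp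
  ultimately show False by blast
qed

lemma H_abelian: "h \<in> H \<Longrightarrow> h' \<in> H \<Longrightarrow> br h h' = 0"
  using H_zero[of "br h h'"] weight_br br_H[of h h' "\<lambda>_. 0"] H_eq by auto

text \<open>A nonzero \<open>H\<close>-stable subspace \<open>U\<close> of \<open>V \<alpha>\<close>
  of least dimension consists of common eigenvectors: as \<open>H\<close> is abelian, the kernel of
  \<open>shift (br h) (\<alpha> h)\<close> on \<open>U\<close> is \<open>H\<close>-stable, and it is
  nonzero by nilpotency, hence all of \<open>U\<close>.\<close>

lemma ex_eigenvector:
  assumes "\<alpha> \<in> weights"
  shows "\<exists>e\<in>V \<alpha>. e \<noteq> 0 \<and> (\<forall>h\<in>H. br h e = \<alpha> h *s e)"
proof -
  let ?P = "\<lambda>U. subspace U \<and> U \<subseteq> V \<alpha> \<and> U \<noteq> {0} \<and> (\<forall>h\<in>H. \<forall>u\<in>U. br h u \<in> U)"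
  have "?P (V \<alpha>)" using assms br_H subspace_weight_space by (simp add: weights_def)
  then obtain U where U: "?P U" "\<And>U'. ?P U' \<Longrightarrow> dim U \<le> dim U'"
    using ex_has_least_nat[of ?P "V \<alpha>" dim] by blast
  have eig: "br h u = \<alpha> h *s u" if h: "h \<in> H" and u: "u \<in> U" for h u
  proof -
    let ?S = "shift (br h) (\<alpha> h)"
    note E = endo_shift[OF endo_br, of h "\<alpha> h"]
    let ?K = "{v \<in> U. ?S v = 0}"
    have sK: "subspace ?K"
      using U(1) by (intro subspaceI) (auto simp: endoD[OF E] subspace_0 subspace_add subspace_scale)
    have "br h' v \<in> ?K" if "h' \<in> H" "v \<in> ?K" for h' v
    proof -
      have "?S (br h' v) = br h' (?S v)"
        using br_br[of h h' v] H_abelian[OF h that(1)]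
        by (simp add: shift_def br_right_simps br_left_simps)
      then show ?thesis using that U(1) by (auto simp: br_right_simps)
    qed
    moreover have "?K \<noteq> {0}"
    proof -
      obtain v where v: "v \<in> U" "v \<noteq> 0" using U(1) subspace_0 by blast
      have "v \<in> gen_eigenspace (br h) (\<alpha> h)" using v(1) U(1) h unfolding weight_space_def by blast
      then have ex: "\<exists>n. (?S ^^ n) v = 0" unfolding gen_eigenspace_def by blast
      define n where "n = (LEAST n. (?S ^^ n) v = 0)"
      have n: "(?S ^^ n) v = 0" "\<And>m. m < n \<Longrightarrow> (?S ^^ m) v \<noteq> 0"
        unfolding n_def using LeastI_ex[OF ex] not_less_Least by blast+
      obtain m where m: "n = Suc m" using n(1) v(2) by (cases n) auto
      have "(?S ^^ m) v \<in> U"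
        by (rule funpow_stable[OF shift_stable]) (use U(1) h v(1) in auto)
      then show ?thesis using n(1) n(2)[of m] m by auto
    qed
    ultimately have "dim U \<le> dim ?K" using sK U(1) by (intro U(2)) auto
    then have "?K = U" using sK U(1) by (intro subspace_dim_equal) auto
    then show ?thesis using u by (auto simp: shift_def)
  qed
  obtain e where "e \<in> U" "e \<noteq> 0" using U(1) subspace_0 by blast
  then show ?thesis using eig U(1) by blast
qed

lemma uminus_weight:
  assumes "\<alpha> \<in> weights"
  shows "(\<lambda>h. - \<alpha> h) \<in> weights"
proof -
  obtain x where "x \<in> V \<alpha>" "x \<noteq> 0" using ex_eigenvector[OF assms] by blast
  then obtain y where "y \<in> V (\<lambda>h. - \<alpha> h)" "killing x y \<noteq> 0"
    using pairing weights_on[OF assms] by blast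
  then show ?thesis
    using on_uminus[OF weights_on[OF assms]] killing_0 unfolding weights_def by auto
qed

text \<open>With \<open>e\<close> an eigenvector of weight \<open>-\<alpha>\<close> and \<open>f\<close> dual to it, the trace of \<open>[e, f]\<close> on
  \<open>k e \<oplus> H \<oplus> V \<alpha> \<oplus> V (2 \<alpha>) \<oplus> \<dots>\<close> vanishes, so \<open>\<Sum>j. j * dim (V (j \<alpha>)) = 1\<close>.\<close>

lemma card_weight_basis_root:
  assumes \<alpha>: "\<alpha> \<in> weights" "\<alpha> \<noteq> (\<lambda>_. 0)"
  shows "card (weight_basis \<alpha>) = 1"
proof -
  let ?m = "\<lambda>h. - \<alpha> h" and ?s = "\<lambda>(j::nat) h. of_nat j * \<alpha> h"
  note on_\<alpha> = weights_on[OF \<alpha>(1)]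
  have on_s: "vanishes_off H (?s j)" for j using on_\<alpha> by (simp add: vanishes_off_def)
  obtain h\<^sub>0 where h\<^sub>0: "\<alpha> h\<^sub>0 \<noteq> 0" using \<alpha>(2) by auto
  have h\<^sub>0H: "h\<^sub>0 \<in> H" using on_\<alpha> h\<^sub>0 unfolding vanishes_off_def by blast
  have m_ne: "?m \<noteq> ?s j" for j
  proof
    assume "?m = ?s j"
    then have "?m h\<^sub>0 = ?s j h\<^sub>0" by (rule fun_cong)
    then have "\<alpha> h\<^sub>0 + ?s j h\<^sub>0 = \<alpha> h\<^sub>0 + ?m h\<^sub>0" by simp
    then have "of_nat (Suc j) * \<alpha> h\<^sub>0 = 0" by (simp add: algebra_simps)
    then show False using h\<^sub>0 of_nat_eq_0_iff by (metis mult_eq_0_iff nat.distinct(1))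
  qed
  obtain e where e: "e \<in> V ?m" "e \<noteq> 0" "\<And>h. h \<in> H \<Longrightarrow> br h e = - \<alpha> h *s e"
    using ex_eigenvector[OF uminus_weight[OF \<alpha>(1)]] by auto
  obtain f where f: "f \<in> V \<alpha>" "killing e f \<noteq> 0"
    using pairing[OF on_uminus[OF on_\<alpha>] e(1,2)] by auto
  let ?h = "br e f"
  have hH: "?h \<in> H" using weight_space_br[OF e(1) f(1)] H_eq by simp
  \<comment> \<open>Invariance turns this pairing into
    \<open>- \<alpha> h\<^sub>0 * killing e f\<close>, which is nonzero, so \<open>?h\<close> is
    nonzero.\<close>
  have "killing ?h h\<^sub>0 = killing (br h\<^sub>0 e) f" using killing_br[of h\<^sub>0 e f] killing_sym by metis
  also have "\<dots> = - \<alpha> h\<^sub>0 * killing e f" by (simp only: e(3)[OF h\<^sub>0H] killing_simps)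
  finally have hne: "?h \<noteq> 0" using h\<^sub>0 f(2) killing_0 by auto
  have \<alpha>h: "\<alpha> ?h \<noteq> 0"
  proof
    assume z: "\<alpha> ?h = 0"
    have "?m \<noteq> (\<lambda>_. 0)" using h\<^sub>0 by (auto simp: fun_eq_iff)
    \<comment> \<open>Every weight at \<open>?h\<close> is a rational multiple of
      \<open>\<alpha> ?h\<close>, so all would vanish, against \<open>H_zero\<close>.\<close>
    then have "\<chi> ?h = 0" if "\<chi> \<in> weights" for \<chi>
      using weight_string[OF on_uminus[OF on_\<alpha>] _ e(1) _ that, of f] f(1) z by auto
    then show False using H_zero[OF hH] hne by blast
  qed
  define X where "X = {\<chi> \<in> weights. \<exists>j. \<chi> = ?s j}"
  have X: "finite X" "X \<subseteq> weights" using finite_weights by (auto simp: X_def)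
  have "\<forall>\<chi>\<in>X. \<exists>j. \<chi> = ?s j" unfolding X_def by blast
  from bchoice[OF this] obtain j where j: "\<And>\<chi>. \<chi> \<in> X \<Longrightarrow> \<chi> = ?s (j \<chi>)" by blast
  have mX: "?m \<notin> X" unfolding X_def using m_ne by blast
  \<comment> \<open>Only the line of \<open>e\<close> is taken from the space of weight -\<alpha>,
    so that it contributes \<open>- \<alpha> ?h\<close> with multiplicity one. Stability survives:
    ad \<open>f\<close> sends \<open>e\<close> into \<open>H\<close>, and ad \<open>e\<close> sends
    \<open>H\<close> to multiples of \<open>e\<close> because \<open>e\<close> is a true
    eigenvector.\<close>
  define C where "C = (\<lambda>\<chi>. if \<chi> = ?m then {e} else weight_basis \<chi>)"
  have C: "C ?m = {e}" "\<chi> \<in> X \<Longrightarrow> C \<chi> = weight_basis \<chi>" for \<chi> using mX by (auto simp: C_def)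
  let ?F = "insert ?m X" and ?M = "\<Union>(C ` insert ?m X)"
  have F: "finite ?F" "\<And>\<chi>. \<chi> \<in> ?F \<Longrightarrow> vanishes_off H \<chi>" "\<And>\<chi>. \<chi> \<in> ?F \<Longrightarrow> C \<chi> \<subseteq> V \<chi>" "\<And>\<chi>. \<chi> \<in> ?F \<Longrightarrow>
      independent (C \<chi>)"
    using X weights_on on_uminus[OF on_\<alpha>] weight_basis(1,2) e(1,2) by (auto simp: C_def)
  have sM: "v \<in> span ?M" if "v \<in> V (?s i)" for v i
  proof (cases "?s i \<in> weights")
    case True
    then have "?s i \<in> X" unfolding X_def by blast
    then have "weight_basis (?s i) \<subseteq> ?M" using C(2) by blast
    then show ?thesis using that weight_basis(3) span_mono by blast
  next
    case False
    then show ?thesis using not_weight[OF on_s] that by (auto simp: span_zero)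
  qed
  have eM: "c *s e \<in> span ?M" for c using C(1) by (intro span_scale span_base) auto
  have brM: "br e b \<in> span ?M \<and> br f b \<in> span ?M" if b: "b \<in> ?M" for b
  proof (cases "b = e")
    case True
    have "br f b = - ?h" using br_antisym True by blast
    moreover have "?h \<in> V (?s 0)" using hH H_eq by simp
    ultimately show ?thesis using sM[of ?h 0] True by (simp add: alternating span_zero span_neg)
  next
    case False
    then obtain \<chi> where \<chi>: "\<chi> \<in> X" "b \<in> weight_basis \<chi>" using b C by auto
    have "b \<in> V \<chi>" using \<chi>(2) weight_basis(1) by blast
    then have bV: "b \<in> V (?s (j \<chi>))" by (subst j[OF \<chi>(1), symmetric])
    have "(\<lambda>h. \<alpha> h + ?s (j \<chi>) h) = ?s (Suc (j \<chi>))" by (simp add: algebra_simps)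
    then have "br f b \<in> span ?M" using weight_space_br[OF f(1) bV] sM by metis
    moreover have "br e b \<in> span ?M"
    proof (cases "j \<chi>")
      case 0
      then have "b \<in> H" using bV H_eq by simp
      then have "br e b = \<alpha> b *s e" using e(3) br_antisym[of e b] by simp
      then show ?thesis using eM by simp
    next
      case (Suc i)
      then have "(\<lambda>h. ?m h + ?s (j \<chi>) h) = ?s i" by (simp add: fun_eq_iff algebra_simps)
      then show ?thesis using weight_space_br[OF e(1) bV] sM by metis
    qed
    ultimately show ?thesis by blast
  qed
  have ind: "independent ?M" by (rule independent_Union_weights[where F = ?F]) (fact F)+
  have "trace_on ?M (br ?h) = 0"
    by (rule trace_on_commutator[OF ind]) (use brM in \<open>blast+\<close>)
  moreover have "trace_on ?M (br ?h) = (\<Sum>\<chi>\<in>?F. \<chi> ?h * of_nat (card (C \<chi>)))"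
  proof (rule trace_on_weights(1)[OF F hH])
    fix \<chi> b assume \<chi>: "\<chi> \<in> ?F" "b \<in> C \<chi>"
    show "br ?h b \<in> span (C \<chi>)"
    proof (cases "\<chi> = ?m")
      case True
      then have C\<chi>: "C \<chi> = {e}" using C(1) by simp
      then have "b = e" using \<chi>(2) by simp
      then show ?thesis unfolding C\<chi> using e(3)[OF hH] span_scale[OF span_base[of e "{e}"]]
          by (metis singletonI)
    next
      case False
      then show ?thesis using \<chi> C(2) br_weight_basis[OF hH] by auto
    qed
  qed
  moreover have "(\<Sum>\<chi>\<in>?F. \<chi> ?h * of_nat (card (C \<chi>))) = - \<alpha> ?h + (\<Sum>\<chi>\<in>X. \<chi> ?h * of_nat (card (weight_basis \<chi>)))"
    using X(1) mX C by simp
  moreover have "(\<Sum>\<chi>\<in>X. \<chi> ?h * of_nat (card (weight_basis \<chi>)))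
      = (\<Sum>\<chi>\<in>X. \<alpha> ?h * of_nat (j \<chi> * card (weight_basis \<chi>)))"
  proof (rule sum.cong[OF refl])
    fix \<chi> assume "\<chi> \<in> X"
    then have "\<chi> ?h = of_nat (j \<chi>) * \<alpha> ?h" using j by metis
    then show "\<chi> ?h * of_nat (card (weight_basis \<chi>)) = \<alpha> ?h * of_nat (j \<chi> * card (weight_basis \<chi>))"
        by simp
  qed
  moreover have "\<dots> = \<alpha> ?h * of_nat (\<Sum>\<chi>\<in>X. j \<chi> * card (weight_basis \<chi>))"
    by (simp add: sum_distrib_left)
  ultimately have "\<alpha> ?h * of_nat (\<Sum>\<chi>\<in>X. j \<chi> * card (weight_basis \<chi>)) = \<alpha> ?h * of_nat 1" by simp
  then have S: "(\<Sum>\<chi>\<in>X. j \<chi> * card (weight_basis \<chi>)) = 1" using \<alpha>h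
      by (metis mult_left_cancel of_nat_eq_iff)
  have "\<alpha> = ?s 1" by simp
  then have \<alpha>X: "\<alpha> \<in> X" using \<alpha>(1) unfolding X_def by (auto intro!: exI[of _ 1])
  \<comment> \<open>In a sum of natural numbers equal to 1, a nonzero position
    \<open>j \<alpha>\<close> already forces the dimension to be 1.\<close>
  have "j \<alpha> \<noteq> 0"
  proof
    assume "j \<alpha> = 0"
    then have "\<alpha> = ?s 0" using j[OF \<alpha>X] by metis
    then show False using \<alpha>(2) by simp
  qed
  moreover have "j \<alpha> * card (weight_basis \<alpha>) \<le> 1"
    using member_le_sum[OF \<alpha>X, of "\<lambda>\<chi>. j \<chi> * card (weight_basis \<chi>)"] X(1) S by simp
  ultimately show ?thesis using card_weight_basis_pos[OF \<alpha>(1)]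
    by (cases "j \<alpha>"; cases "card (weight_basis \<alpha>)") auto
qed

lemma ex_root_vector:
  assumes \<alpha>: "\<alpha> \<in> weights" "\<alpha> \<noteq> (\<lambda>_. 0)"
  shows "\<exists>e. V \<alpha> = span {e} \<and> (\<forall>h\<in>H. br h e = \<alpha> h *s e)"
proof -
  obtain e where e: "e \<in> V \<alpha>" "e \<noteq> 0" "\<forall>h\<in>H. br h e = \<alpha> h *s e"
    using ex_eigenvector[OF \<alpha>(1)] by blast
  have "dim (V \<alpha>) = 1"
    using dim_span_eq_card_independent[OF weight_basis(2)] card_weight_basis_root[OF \<alpha>] weight_basis(3)[of \<alpha>] by metis
  then have "span {e} = V \<alpha>"
    using e(1,2) by (intro subspace_dim_equal subspace_weight_space span_minimal) auto
  then show ?thesis using e(3) by blast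
qed

section \<open>Generation by two elements\<close>

lemma ex_killing_orthogonal:
  assumes D: "subspace D" "D \<noteq> UNIV"
  shows "\<exists>x. x \<noteq> 0 \<and> (\<forall>d\<in>D. killing x d = 0)"
proof -
  obtain B where B: "B \<subseteq> D" "independent B" "span B = D"
    by (rule basis_subspace_exists[OF D(1)]) blast
  have fin: "finite B" using B(2) finiteI_independent by blast
  let ?S = "\<lambda>x. \<Sum>b\<in>B. killing x b *s b"
  have lin: "endo ?S"
    by (simp add: endo_iff killing_simps scale_left_distrib sum.distrib scale_sum_right)
  have "range ?S \<subseteq> D" using B(1) D(1) by (auto intro!: subspace_sum subspace_scale)
  \<comment> \<open>In finite dimension a map that is not onto has a kernel vector. As
    \<open>B\<close> is independent, a vector killed by \<open>?S\<close> is orthogonal to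
    \<open>B\<close>, hence to \<open>D\<close>.\<close>
  then have "\<not> surj ?S" using D(2) by blast
  then have "\<not> inj ?S" using linear_inj_imp_surj[OF lin] by blast
  then obtain y z where yz: "?S y = ?S z" "y \<noteq> z" by (auto simp: inj_def)
  then have "?S (y - z) = 0" using endoD(4)[OF lin, of y z] by simp
  then have "killing (y - z) b = 0" if "b \<in> B" for b
    using independentD[OF B(2) fin order_refl _ that] by blast
  then have "B \<subseteq> {d. killing (y - z) d = 0}" by blast
  moreover have "subspace {d. killing (y - z) d = 0}"
    by (rule subspaceI) (auto simp: killing_simps killing_0)
  ultimately have "D \<subseteq> {d. killing (y - z) d = 0}" using span_minimal B(3) by blast
  then show ?thesis using yz(2) by (intro exI[of _ "y - z"]) auto
qed

text \<open>A vector orthogonal to all brackets is central, by invariance and nondegeneracy, and a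
  central vector lies in the Killing radical.\<close>

lemma perfect: "span {br x y | x y. True} = UNIV"
proof (rule ccontr)
  assume "span {br x y | x y. True} \<noteq> UNIV"
  then obtain x where x: "x \<noteq> 0" "\<And>d. d \<in> span {br x y | x y. True} \<Longrightarrow> killing x d = 0"
    using ex_killing_orthogonal[OF subspace_span] by blast
  have "killing (br x y) z = 0" for y z
    unfolding killing_br by (rule x(2)[OF span_base]) blast
  then have "br x y = 0" for y using killing_nondegenerate by blast
  then have "killing x y = 0" for y by (simp add: killing_def trace_on_def representation_zero)
  then show False using killing_nondegenerate x(1) by blast
qed

text \<open>A vector space over an infinite field is not a finite union of hyperplanes: on a line
  through a good point for \<open>P\<close> and in a direction good for \<open>q\<close>, each form
  vanishes at most once.\<close>

lemma ex_nonvanishing: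
  assumes "finite P"
  shows "(\<And>p. p \<in> P \<Longrightarrow>
      (\<forall>x\<in>H. \<forall>y\<in>H. p (x + y) = p x + p y) \<and> (\<forall>c. \<forall>x\<in>H. p (c *s x) = c * p x) \<and> (\<exists>x\<in>H. p x \<noteq> (0::'k)))
    \<Longrightarrow> \<exists>h\<in>H. \<forall>p\<in>P. p h \<noteq> 0"
  using assms
proof (induction P rule: finite_induct)
  case empty
  then show ?case using subspace_0[OF subspace_H] by blast
next
  case (insert q P)
  then obtain h where h: "h \<in> H" "\<And>p. p \<in> P \<Longrightarrow> p h \<noteq> 0" by auto
  obtain h' where h': "h' \<in> H" "q h' \<noteq> 0" using insert.prems[of q] by blast
  \<comment> \<open>The parameters at which a form vanishes on the line. If \<open>p h' = 0\<close>,
    then \<open>p\<close> is a nonzero constant there, and the value 0 produced by division by zero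
    merely excludes one more \<open>t\<close>.\<close>
  let ?B = "insert (- q h / q h') ((\<lambda>p. - p h / p h') ` P)"
  have "finite ?B" using insert.hyps by blast
  then obtain t where t: "t \<notin> ?B" using ex_new_if_finite infinite_UNIV_char_0 by blast
  have "p (h + t *s h') \<noteq> 0" if p: "p \<in> insert q P" for p
  proof
    assume "p (h + t *s h') = 0"
    then have z: "p h + t * p h' = 0"
      using insert.prems[OF p] h(1) h'(1) subspace_scale[OF subspace_H] by simp
    have "p h' \<noteq> 0" using z p h(2) h'(2) by auto
    then have "t = - p h / p h'"
      using z by (intro nonzero_eq_divide_eq[THEN iffD2]) (simp_all add: eq_neg_iff_add_eq_0 add.commute)
    then show False using t p by auto
  qed
  moreover have "h + t *s h' \<in> H" using h(1) h'(1) subspace_H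
      by (simp add: subspace_add subspace_scale)
  ultimately show ?case by blast
qed

lemma ex_separating: "\<exists>h\<in>H. inj_on (\<lambda>\<chi>. \<chi> h) weights"
proof -
  let ?I = "{(\<alpha>, \<beta>) \<in> weights \<times> weights. \<alpha> \<noteq> \<beta>}"
  let ?P = "(\<lambda>(\<alpha>, \<beta>) h. \<alpha> h - \<beta> h :: 'k) ` ?I"
  have "finite ?I" using finite_weights by (auto intro: finite_subset[of _ "weights \<times> weights"])
  have "\<exists>h\<in>H. \<forall>p\<in>?P. p h \<noteq> 0"
  proof (rule ex_nonvanishing)
    fix p assume "p \<in> ?P"
    then obtain \<alpha> \<beta> where p: "p = (\<lambda>h. \<alpha> h - \<beta> h)" "\<alpha> \<in> weights" "\<beta> \<in> weights" "\<alpha> \<noteq> \<beta>" by auto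
    obtain x where x: "\<alpha> x \<noteq> \<beta> x" using p(4) by blast
    then have "x \<in> H" using weights_on[OF p(2)] weights_on[OF p(3)] unfolding vanishes_off_def
        by force
    then show "(\<forall>x\<in>H. \<forall>y\<in>H. p (x + y) = p x + p y) \<and> (\<forall>c. \<forall>x\<in>H. p (c *s x) = c * p x) \<and> (\<exists>x\<in>H. p x \<noteq> 0)"
      using x p by (auto simp: weight_add weight_scale right_diff_distrib)
  qed (use \<open>finite ?I\<close> in blast)
  then obtain h where h: "h \<in> H" "\<And>p. p \<in> ?P \<Longrightarrow> p h \<noteq> 0" by blast
  have "inj_on (\<lambda>\<chi>. \<chi> h) weights"
  proof (rule inj_onI, rule ccontr)
    fix \<alpha> \<beta> assume "\<alpha> \<in> weights" "\<beta> \<in> weights" "\<alpha> h = \<beta> h" "\<alpha> \<noteq> \<beta>"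
    then show False using h(2)[of "\<lambda>h. \<alpha> h - \<beta> h"] by force
  qed
  then show ?thesis using h(1) by blast
qed

text \<open>Subtracting \<open>c b\<close> times the sum from its image under \<open>br u\<close>
  removes the \<open>b\<close>-component and scales the others by nonzero factors, so the components
  can be isolated inductively, in place of a Vandermonde determinant.\<close>

lemma eigen_components:
  assumes S: "subspace S" "\<And>v. v \<in> S \<Longrightarrow> br u v \<in> S"
  shows "finite F \<Longrightarrow> inj_on c F \<Longrightarrow> (\<And>a. a \<in> F \<Longrightarrow> br u (x a) = c a *s x a) \<Longrightarrow> (\<Sum>a\<in>F. x a) \<in> S \<Longrightarrow> a \<in> F \<Longrightarrow>
      x a \<in> S"
proof (induction F arbitrary: x a rule: finite_induct)
  case (insert b F)
  let ?\<Sigma> = "\<Sum>a\<in>insert b F. x a"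
  have "br u ?\<Sigma> - c b *s ?\<Sigma> \<in> S"
    by (intro subspace_diff[OF S(1)] subspace_scale[OF S(1)] S(2) insert.prems(3))
  also have "br u ?\<Sigma> = (\<Sum>a\<in>insert b F. c a *s x a)"
    unfolding br_right_simps by (intro sum.cong refl insert.prems(2))
  also have "\<dots> - c b *s ?\<Sigma> = (\<Sum>a\<in>F. (c a - c b) *s x a)"
    using insert.hyps by (simp add: scale_left_diff_distrib sum_subtractf scale_sum_right scale_right_distrib)
  finally have s: "(\<Sum>a\<in>F. (c a - c b) *s x a) \<in> S" .
  have F: "x a \<in> S" if a: "a \<in> F" for a
  proof -
    have "(c a - c b) *s x a \<in> S"
      using insert.prems(1,2)
          by (intro insert.IH[OF _ _ s a]) (auto simp: br_right_simps mult.commute)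
    moreover have "c a - c b \<noteq> 0" using insert.prems(1) insert.hyps(2) a by (auto simp: inj_on_def)
    ultimately show ?thesis using subspace_scale[OF S(1), of "(c a - c b) *s x a"
        "inverse (c a - c b)"] by simp
  qed
  moreover have "x b \<in> S"
    using subspace_diff[OF S(1) insert.prems(3), of "sum x F"] subspace_sum[OF S(1), of F x] F insert.hyps by simp
  ultimately show ?case using insert.prems(4) by blast
qed simp

text \<open>Generation is expressed through all subalgebras \<open>S\<close> containing
  \<open>u\<close> and \<open>v\<close>, the form in which it is applied to the range of a
  morphism.\<close>

lemma two_generated:
  "\<exists>u v. \<forall>S. subspace S \<longrightarrow> (\<forall>x\<in>S. \<forall>y\<in>S. br x y \<in> S) \<longrightarrow> u \<in> S \<longrightarrow> v \<in> S \<longrightarrow> S = UNIV"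
proof -
  obtain u where u: "u \<in> H" "inj_on (\<lambda>\<chi>. \<chi> u) weights" using ex_separating by blast
  let ?R = "weights - {\<lambda>_. 0}"
  have "\<forall>\<alpha>\<in>?R. \<exists>e. V \<alpha> = span {e} \<and> (\<forall>h\<in>H. br h e = \<alpha> h *s e)" using ex_root_vector by blast
  from bchoice[OF this] obtain e where
    e: "\<And>\<alpha>. \<alpha> \<in> ?R \<Longrightarrow> V \<alpha> = span {e \<alpha>}" "\<And>\<alpha>. \<alpha> \<in> ?R \<Longrightarrow> br u (e \<alpha>) = \<alpha> u *s e \<alpha>" using u(1) by blast
  have "S = UNIV" if S: "subspace S" "\<And>x y. x \<in> S \<Longrightarrow> y \<in> S \<Longrightarrow> br x y \<in> S" "u \<in> S"
      "(\<Sum>\<alpha>\<in>?R. e \<alpha>) \<in> S" for S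
  proof -
    have "e \<alpha> \<in> S" if "\<alpha> \<in> ?R" for \<alpha>
      by (rule eigen_components[OF S(1) S(2)[OF S(3)] _ _ e(2) S(4) that])
         (use finite_weights u(2) in \<open>auto intro: inj_on_subset\<close>)
    then have VS: "V \<alpha> \<subseteq> S" if "\<alpha> \<in> ?R" for \<alpha>
      unfolding e(1)[OF that] using that by (intro span_minimal S(1)) auto
    let ?B = "\<Union>(weight_basis ` weights)"
    \<comment> \<open>\<open>H\<close> is not yet known to lie in \<open>S\<close>, but brackets
      involving it do: elements of \<open>H\<close> commute with each other and preserve the root
      spaces. Perfectness then recovers everything, \<open>H\<close> included.\<close>
    have bB: "br b b' \<in> S" if bb: "b \<in> ?B" "b' \<in> ?B" for b b'
    proof -
      obtain \<alpha> \<beta> where \<alpha>\<beta>: "\<alpha> \<in> weights" "b \<in> V \<alpha>" "\<beta> \<in> weights" "b' \<in> V \<beta>"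
        using bb weight_basis(1) by blast
      show ?thesis
      proof (cases "\<alpha> = (\<lambda>_. 0)")
        case True
        then have b: "b \<in> H" using \<alpha>\<beta>(2) H_eq by simp
        show ?thesis
        proof (cases "\<beta> = (\<lambda>_. 0)")
          case True
          then show ?thesis using H_abelian[OF b, of b'] \<alpha>\<beta>(4) H_eq subspace_0[OF S(1)] by simp
        next
          case False
          then show ?thesis using br_H[OF b \<alpha>\<beta>(4)] VS \<alpha>\<beta>(3) by blast
        qed
      next
        case False
        then have b: "b \<in> S" using VS \<alpha>\<beta> by blast
        show ?thesis
        proof (cases "\<beta> = (\<lambda>_. 0)")
          case True
          then have "br b b' \<in> V \<alpha>" using weight_space_br[OF \<alpha>\<beta>(2,4)] by simp
          then show ?thesis using VS \<alpha>\<beta>(1) False by blast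
        next
          case False
          then show ?thesis using VS \<alpha>\<beta> b S(2) by blast
        qed
      qed
    qed
    have "br x y \<in> S" for x y
      by (rule br_span_mem[of ?B ?B, OF bB S(1)]) (simp_all add: span_weight_basis)
    then have "span {br x y | x y. True} \<subseteq> S" by (intro span_minimal S(1)) blast
    then show ?thesis using perfect by blast
  qed
  then show ?thesis by blast
qed

end

section \<open>Homomorphisms out of the Yang-Mills algebra\<close>

context lie_algebra
begin

section \<open>Evaluation of nonassociative polynomials and its descent to quotients\<close>

primrec magma_eval :: "('n \<Rightarrow> 'a) \<Rightarrow> 'n magma \<Rightarrow> 'a" where
  "magma_eval a (Gen i) = a i"
| "magma_eval a (Node s t) = br (magma_eval a s) (magma_eval a t)"

definition eval_magma_algebra :: "('n \<Rightarrow> 'a) \<Rightarrow> ('n magma \<Rightarrow>\<^sub>0 'k) \<Rightarrow> 'a" where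
  "eval_magma_algebra a p = (\<Sum>t\<in>Poly_Mapping.keys p. Poly_Mapping.lookup p t *s magma_eval a t)"

lemma br_zero: "br 0 y = 0" "br x 0 = 0"
  using br_scale_left[of 0 0 y] br_scale_right[of x 0 0] by simp_all

lemma br_sum: "br (sum f A) y = (\<Sum>i\<in>A. br (f i) y)" "br x (sum f A) = (\<Sum>i\<in>A. br x (f i))"
  by (induction A rule: infinite_finite_induct) (simp_all add: br_zero br_add_left br_add_right)

lemma eval_superset:
  "finite A \<Longrightarrow> Poly_Mapping.keys p \<subseteq> A \<Longrightarrow>
    eval_magma_algebra a p = (\<Sum>t\<in>A. Poly_Mapping.lookup p t *s magma_eval a t)"
  unfolding eval_magma_algebra_def by (intro sum.mono_neutral_left) (auto simp: in_keys_iff)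

lemma eval_add: "eval_magma_algebra a (p + q) = eval_magma_algebra a p + eval_magma_algebra a q"
proof -
  let ?A = "Poly_Mapping.keys p \<union> Poly_Mapping.keys q"
  have "Poly_Mapping.keys (p + q) \<subseteq> ?A" by (rule Poly_Mapping.keys_add)
  then show ?thesis
    by (simp add: eval_superset[of ?A] lookup_add scale_left_distrib sum.distrib)
qed

lemma eval_scale: "eval_magma_algebra a (magma_scale c p) = c *s eval_magma_algebra a p"
proof -
  have "Poly_Mapping.keys (magma_scale c p) \<subseteq> Poly_Mapping.keys p" by (auto simp: in_keys_iff)
  then show ?thesis
    by (simp add: eval_superset[of "Poly_Mapping.keys p"] scale_sum_right)
qed

lemma eval_mult: "eval_magma_algebra a (magma_mult p q) = br (eval_magma_algebra a p) (eval_magma_algebra a q)"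
proof -
  let ?N = "\<lambda>(r, s). Node r s" and ?K = "Poly_Mapping.keys p \<times> Poly_Mapping.keys q"
  have "Poly_Mapping.keys (magma_mult p q) \<subseteq> ?N ` ?K"
  proof
    fix t assume "t \<in> Poly_Mapping.keys (magma_mult p q)"
    then show "t \<in> ?N ` ?K" by (cases t) (auto simp: in_keys_iff lookup_magma_mult)
  qed
  then have "eval_magma_algebra a (magma_mult p q)
      = (\<Sum>t\<in>?N ` ?K. Poly_Mapping.lookup (magma_mult p q) t *s magma_eval a t)"
    by (intro eval_superset) auto
  also have "\<dots> = (\<Sum>(r, s)\<in>?K. (Poly_Mapping.lookup p r * Poly_Mapping.lookup q s) *s br (magma_eval a r) (magma_eval a s))"
    by (subst sum.reindex) (auto simp: inj_on_def lookup_magma_mult intro!: sum.cong)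
  also have "\<dots> = br (eval_magma_algebra a p) (eval_magma_algebra a q)"
    unfolding eval_magma_algebra_def br_sum sum.cartesian_product[symmetric]
    by (subst sum.swap, simp add: br_scale_left br_scale_right mult.commute)
  finally show ?thesis .
qed

lemma eval_gen: "eval_magma_algebra a (Poly_Mapping.single (Gen i) 1) = a i"
  by (simp add: eval_magma_algebra_def)

lemma eval_diff: "eval_magma_algebra a (p - q) = eval_magma_algebra a p - eval_magma_algebra a q"
  using eval_add[of a "p - q" q] by simp

text \<open>The kernel of evaluation is an ideal containing the alternating and Jacobi relators,
  hence the ideal they generate.\<close>

lemma eval_free_lie_rel:
  assumes "free_lie_rel p q"
  shows "eval_magma_algebra a p = eval_magma_algebra a q"
proof -
  let ?K = "{p. eval_magma_algebra a p = 0}"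
  have "free_magma_algebra.ideal ?K"
    unfolding free_magma_algebra.ideal_def
    by (auto intro!: free_magma_algebra.subspaceI simp: eval_add eval_scale eval_mult br_zero)
      (simp add: eval_magma_algebra_def)
  moreover have "free_lie_relators \<subseteq> ?K"
    by (auto simp: free_lie_relators_def eval_mult eval_add alternating jacobi)
  ultimately have "free_magma_algebra.ideal hull free_lie_relators \<subseteq> ?K"
    by (rule hull_minimal[rotated])
  then show ?thesis using assms unfolding free_lie_rel_def by (auto simp: eval_diff)
qed

lift_definition eval_free_lie :: "('n \<Rightarrow> 'a) \<Rightarrow> ('n, 'k) free_lie \<Rightarrow> 'a" is eval_magma_algebra
  by (rule eval_free_lie_rel)

lemma eval_free_lie_simps:
  "eval_free_lie a (x + y) = eval_free_lie a x + eval_free_lie a y"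
  "eval_free_lie a (x - y) = eval_free_lie a x - eval_free_lie a y"
  "eval_free_lie a (free_lie_scale c x) = c *s eval_free_lie a x"
  "eval_free_lie a (free_lie_br x y) = br (eval_free_lie a x) (eval_free_lie a y)"
  "eval_free_lie a (free_lie_gen i) = a i"
  by (transfer; simp add: eval_add eval_diff eval_scale eval_mult eval_gen)+

lemma eval_free_lie_0: "eval_free_lie a 0 = 0"
  using eval_free_lie_simps(2)[of a 0 0] by simp

lemma eval_free_lie_sum: "eval_free_lie a (sum f A) = (\<Sum>i\<in>A. eval_free_lie a (f i))"
  by (induction A rule: infinite_finite_induct) (simp_all add: eval_free_lie_0 eval_free_lie_simps)

text \<open>Descent to the quotient is available for tuples satisfying \<open>rel\<close>, so the
  morphism is built inside the proof from representatives, and its values on classes are identified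
  afterwards.\<close>

theorem yang_mills_universal:
  fixes a :: "'n::finite \<Rightarrow> 'a"
  assumes rel: "\<And>j. (\<Sum>i\<in>UNIV. br (a i) (br (a i) (a j))) = 0"
  shows "\<exists>f :: ('n, 'k) yang_mills \<Rightarrow> 'a.
    lie_algebra_hom yang_mills_scale yang_mills_br scale br f \<and> (\<forall>i. a i \<in> range f)"
proof -
  let ?K = "{x. eval_free_lie a x = 0}"
  have "free_lie.ideal ?K"
    unfolding free_lie.ideal_def
    by (auto intro!: free_lie.subspaceI simp: eval_free_lie_simps br_zero eval_free_lie_0)
  moreover have "yang_mills_relators \<subseteq> ?K"
    using rel by (auto simp: yang_mills_relators_def eval_free_lie_sum eval_free_lie_simps)
  ultimately have "free_lie.ideal hull yang_mills_relators \<subseteq> ?K"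
    by (rule hull_minimal[rotated])
  then have resp: "eval_free_lie a x = eval_free_lie a y" if "yang_mills_rel x y" for x y
    using that unfolding yang_mills_rel_def by (auto simp: eval_free_lie_simps)
  define f where "f X = eval_free_lie a (rep_yang_mills X)" for X :: "('n, 'k) yang_mills"
  have f: "f (abs_yang_mills x) = eval_free_lie a x" for x
    unfolding f_def by (rule resp) (metis Quotient3_abs_rep Quotient3_yang_mills yang_mills.abs_eq_iff)
  have ex: "\<exists>x. X = abs_yang_mills x" for X :: "('n, 'k) yang_mills"
    by (metis Quotient3_abs_rep Quotient3_yang_mills)
  have "lie_algebra_hom yang_mills_scale yang_mills_br scale br f"
  proof unfold_locales
    fix X Y :: "('n, 'k) yang_mills" and c
    obtain x y where xy: "X = abs_yang_mills x" "Y = abs_yang_mills y" using ex by metis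
    show "f (X + Y) = f X + f Y"
      by (simp add: xy plus_yang_mills.abs_eq f eval_free_lie_simps)
    show "f (yang_mills_scale c X) = c *s f X"
      by (simp add: xy yang_mills_scale.abs_eq f eval_free_lie_simps)
    show "f (yang_mills_br X Y) = br (f X) (f Y)"
      by (simp add: xy yang_mills_br.abs_eq f eval_free_lie_simps)
  qed
  moreover have "a i = f (abs_yang_mills (free_lie_gen i))" for i
    by (simp add: f eval_free_lie_simps)
  then have "a i \<in> range f" for i by (metis rangeI)
  ultimately show ?thesis by blast
qed

text \<open>The square of \<open>br (\<iota> *s w)\<close> is minus the square of
  \<open>br w\<close>, so each of \<open>u\<close> and \<open>v\<close> cancels against its partner
  and the sum of the squares of the \<open>br (a i)\<close> is zero on every vector. Two elements
  thus cost four generators.\<close>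

lemma ex_yang_mills_hom:
  fixes u v :: 'a and \<iota> :: 'k
  assumes \<iota>: "\<iota> * \<iota> = - 1" and card: "CARD('n::finite) \<ge> 4"
  shows "\<exists>f :: ('n, 'k) yang_mills \<Rightarrow> 'a.
    lie_algebra_hom yang_mills_scale yang_mills_br scale br f \<and> u \<in> range f \<and> v \<in> range f"
proof -
  obtain A :: "'n set" where A: "card A = 4"
    using obtain_subset_with_card_n[OF card] by blast
  then obtain i1 i2 i3 i4 where i: "distinct [i1, i2, i3, i4 :: 'n]"
    by (auto simp: numeral_eq_Suc card_Suc_eq)
  define a where "a i = (if i = i1 then u else if i = i2 then \<iota> *s u else if i = i3 then v
    else if i = i4 then \<iota> *s v else 0)" for i
  have a: "a i1 = u" "a i2 = \<iota> *s u" "a i3 = v" "a i4 = \<iota> *s v" using i by (auto simp: a_def)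
  have neg: "br (\<iota> *s w) (br (\<iota> *s w) z) = - br w (br w z)" for w z
  proof -
    have "br (\<iota> *s w) (br (\<iota> *s w) z) = (\<iota> * \<iota>) *s br w (br w z)"
      by (simp add: br_scale_left br_scale_right)
    then show ?thesis using \<iota> by simp
  qed
  have "(\<Sum>i\<in>UNIV. br (a i) (br (a i) z)) = 0" for z
  proof -
    have "(\<Sum>i\<in>UNIV. br (a i) (br (a i) z)) = (\<Sum>i\<in>{i1, i2, i3, i4}. br (a i) (br (a i) z))"
      by (rule sum.mono_neutral_right) (auto simp: a_def br_zero)
    also have "\<dots> = 0" using i by (simp add: a neg)
    finally show ?thesis .
  qed
  from yang_mills_universal[of a, OF this] obtain f :: "('n, 'k) yang_mills \<Rightarrow> 'a" where
    f: "lie_algebra_hom yang_mills_scale yang_mills_br scale br f \<and> (\<forall>i. a i \<in> range f)" ..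
  then have "\<forall>i. a i \<in> range f" by (rule conjunct2)
  then have "a i1 \<in> range f" "a i3 \<in> range f" by simp_all
  then show ?thesis using f unfolding a by (intro exI[of _ f] conjI) simp_all
qed

end

theorem corollary2p3:
  fixes scale :: "'k::{alg_closed_field, field_char_0} \<Rightarrow> 'g::ab_group_add \<Rightarrow> 'g"
    and br :: "'g \<Rightarrow> 'g \<Rightarrow> 'g"
  assumes "CARD('n::finite) \<ge> 4"
    and "semisimple_lie_algebra scale br"
  shows "\<exists>f :: ('n, 'k) yang_mills \<Rightarrow> 'g.
           lie_algebra_hom yang_mills_scale yang_mills_br scale br f \<and> surj f"
proof -
  interpret L: semisimple_lie_algebra scale br by (fact assms(2))
  obtain B where B: "finite B" "L.span B = UNIV" using L.finite_dimensional by blast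
  \<comment> \<open>Finite dimension is given by a spanning set, whereas the locale
    \<open>fd_lie\<close> carries a basis.\<close>
  obtain Basis where Basis: "Basis \<subseteq> B" "L.independent Basis" "B \<subseteq> L.span Basis"
    by (rule L.maximal_independent_subset)
  interpret fd_lie scale br Basis
  proof unfold_locales
    show "finite Basis" using Basis(1) B(1) finite_subset by blast
    show "L.span Basis = UNIV"
      using Basis(3) B(2) L.span_minimal[OF _ L.subspace_span] by blast
  qed (fact Basis(2))
  obtain H where H: "H = weight_space H (\<lambda>_. 0)" using ex_cartan by blast
  interpret semisimple_cartan scale br Basis H
    by unfold_locales (fact H L.solvable_ideal_trivial)+
  obtain u v where uv: "\<And>S. L.subspace S \<Longrightarrow> (\<forall>x\<in>S. \<forall>y\<in>S. br x y \<in> S) \<Longrightarrow> u \<in> S \<Longrightarrow> v \<in> S \<Longrightarrow> S = UNIV"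
    using two_generated by blast
  obtain \<iota> :: 'k where "\<iota> ^ 2 = - 1" using nth_root_exists[of 2 "- 1"] by auto
  then have "\<iota> * \<iota> = - 1" by (simp add: power2_eq_square)
  from L.ex_yang_mills_hom[OF this assms(1), of u v] obtain f :: "('n, 'k) yang_mills \<Rightarrow> 'g" where
    f: "lie_algebra_hom yang_mills_scale yang_mills_br scale br f" "u \<in> range f" "v \<in> range f"
    by (elim exE conjE) (rule that)
  interpret f: lie_algebra_hom yang_mills_scale yang_mills_br scale br f by (fact f(1))
  have "range f = UNIV"
  proof (rule uv)
    show "L.subspace (range f)" using f.subspace_image[OF yang_mills.subspace_UNIV] .
    show "\<forall>x\<in>range f. \<forall>y\<in>range f. br x y \<in> range f" by (auto simp flip: f.map_br)
  qed (fact f)+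
  then show ?thesis using f(1) by blast
qed

end
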